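(* Let $Y^-=Y(\Gamma^-,v_0^-)$ and $Y^+=Y(\Gamma^+,v_0^+)$ be knot complements represented by weakly negative definite plumbing pairs, with linking matrices $M^-$ and $M^+$, and let $Y=Y^-\cup_{T^2}Y^+=Y(\Gamma)$ be the result of the standard gluing along their torus boundary, where $\Gamma$ (with linking matrix $M$) is the tree obtained by identifying $v_0^-$ with $v_0^+$ and adding their weights; assume $\Gamma$ is weakly negative definite. Let $a^{\pm}\in \mathrm{Spin}^c(Y^{\pm},\partial Y^{\pm})$ be relative $\mathrm{Spin}^c$ structures which glue to $a\in\mathrm{Spin}^c(Y)$. Then $$\widehat Z_a(Y;q)=(-1)^{\tau}q^{\xi}\sum_{n\in\mathbb Z}\oint_{|z|=1}\frac{dz}{2\pi i z}\,\widehat Z_{a^-}(Y^-;z,n,q)\,\widehat Z_{a^+}(Y^+;z,n,q),$$ where $$\tau=\pi(M)-\pi(M^-)-\pi(M^+)\in\mathbb Z,$$ $$\xi=\tfrac34\bigl(\sigma(M)-\sigma(M^-)-\sigma(M^+)\bigr)-\tfrac14\Bigl((\vec a,M^{-1}\vec a)-(\vec a^-,(M^-)^{-1}\vec a^-)-(\vec a^+,(M^+)^{-1}\vec a^+)\Bigr)\in\mathbb Q,$$ with $\vec a^{\pm}$ representatives of $a^{\pm}$ and $\vec a=\vec a^-*\vec a^+$ the glued representative of $a$.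
   Context: Plumbings. A plumbing tree $\Gamma$ is a finite tree with vertex set $\mathrm{Vert}$, $|\mathrm{Vert}|=s$, and integer weights $m_v$. Its linking matrix $M$ is the symmetric $s\times s$ matrix with $M_{vv}=m_v$, $M_{uv}=1$ if $u\ne v$ are adjacent, and $0$ otherwise. $\pi(M)$ is the number of positive eigenvalues of $M$, $\sigma(M)$ its signature, $\vec\delta=(\deg v)_v$. $Y(\Gamma)$ is the closed oriented 3-manifold bounding the plumbing of disk bundles over $S^2$ given by $\Gamma$. $\Gamma$ is weakly negative definite if $M$ is invertible and $M^{-1}$ is negative definite on the span of the vertices of degree $\ge 3$. There is an identification $\mathrm{Spin}^c(Y(\Gamma))\cong(2\mathbb Z^s+\vec\delta)/(2M\mathbb Z^s)$. Contour integrals. $\oint_{|z|=1}\frac{dz}{2\pi i z}$ always means the principal value: the average of the integrals over $|z|=1+\epsilon$ and $|z|=1-\epsilon$. Formally: combine all powers of $(z-1/z)$ into a single one, replace it by the average of its Laurent expansions at $z\to0$ and $z\to\infty$, and take the constant coefficient in $z$ of the product with the remaining formal series. Closed invariant. For $\Gamma$ weakly negative definite and $a=[\vec a]$, $$\widehat Z_a(Y;q)=(-1)^{\pi(M)}q^{\frac{3\sigma(M)-\sum_v m_v}{4}}\oint\prod_{v}\frac{dz_v}{2\pi i z_v}\Bigl(z_v-\frac1{z_v}\Bigr)^{2-\deg v}\sum_{\vec\ell\in 2M\mathbb Z^s+\vec a}q^{-\frac{(\vec\ell,M^{-1}\vec\ell)}4}\prod_v z_v^{\ell_v}.$$ Knot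 complements. Given $\Gamma$ and a distinguished vertex $v_0$, let $\hat\Gamma=\Gamma\setminus v_0$; $Y(\Gamma,v_0)$ is the complement in $Y(\hat\Gamma)$ of the knot given by the unknot component of $v_0$, with boundary parametrized by the meridian $\mu$ and the graph longitude $\lambda$ (framing $m_{v_0}$). The pair $(\Gamma,v_0)$ is weakly negative definite if $M$ is invertible and $M^{-1}$ is negative definite on the span of the non-distinguished vertices of degree $\ge3$. Relative $\mathrm{Spin}^c$ structures are identified as $\mathrm{Spin}^c(Y,\partial Y)\cong(2\mathbb Z^s+\vec\delta)/(2M\mathbb Z^{s-1})$, where $\mathbb Z^{s-1}\subset\mathbb Z^s$ consists of vectors whose $v_0$-entry is $0$. For $a=[\vec a]$ and $n\in\mathbb Z$, $$\widehat Z_a(Y;z,n,q)=(-1)^{\pi(M)}\Bigl(z-\frac1z\Bigr)^{1-\deg v_0}q^{\frac{3\sigma(M)-\sum_v m_v}{4}}\oint\prod_{v\ne v_0}\frac{dz_v}{2\pi i z_v}\Bigl(z_v-\frac1{z_v}\Bigr)^{2-\deg v}\sum_{\vec\ell}q^{-\frac{(\vec\ell,M^{-1}\vec\ell)}4}\prod_{v}z_v^{\ell_v},$$ where $z_{v_0}=z$ and the sum is over $\vec\ell=2M\vec n+\vec a$ with $\vec n\in\mathbb Z^s$ and $n_{v_0}=n$. Standard gluing. $Y^-$ and $Y^+$ are glued so that $\lambda^-$ is identified with $\lambda^+$ and $\mu^-$ with $-\mu^+$; the result is $Y(\Gamma)$ with $\Gamma$ as in the claim. $\mathrm{Spin}^c$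 structures glue by $([\vec a^-],[\vec a^+])\mapsto[\vec a^-*\vec a^+]$, where $\vec a^-*\vec a^+$ has the entries of $\vec a^{\pm}$ at vertices other than the merged one, and entry $a^-_{v_0^-}+a^+_{v_0^+}$ at the merged vertex. The number $\xi$ does not depend on the choice of representatives. *)

theory Defs
  imports
    "HOL-Analysis.Analysis"
    "HOL-Computational_Algebra.Computational_Algebra"
    "HOL-Library.Groups_Big_Fun"
begin

section \<open>Plumbing trees\<close>

text \<open>The vertex set is the whole (finite) type \<open>'v\<close>.\<close>

datatype 'v plumbing = Plumbing (adj: "'v \<Rightarrow> 'v \<Rightarrow> bool") (weight: "'v \<Rightarrow> int")

definition graph_cycle :: "'v plumbing \<Rightarrow> 'v list \<Rightarrow> bool" where
  "graph_cycle \<Gamma> c \<longleftrightarrow>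
     length c \<ge> 3 \<and> distinct c \<and> successively (adj \<Gamma>) c \<and> adj \<Gamma> (last c) (hd c)"

definition plumbing_tree :: "'v::finite plumbing \<Rightarrow> bool" where
  "plumbing_tree \<Gamma> \<longleftrightarrow>
     symp (adj \<Gamma>) \<and> irreflp (adj \<Gamma>) \<and>
     (\<forall>u v. (adj \<Gamma>)\<^sup>*\<^sup>* u v) \<and> (\<nexists>c. graph_cycle \<Gamma> c)"

definition degree_of :: "'v::finite plumbing \<Rightarrow> 'v \<Rightarrow> int" where
  "degree_of \<Gamma> v = int (card {u. adj \<Gamma> v u})"

definition degree_vec :: "'v::finite plumbing \<Rightarrow> int ^ 'v" where
  "degree_vec \<Gamma> = (\<chi> v. degree_of \<Gamma> v)"

text \<open>The linking matrix is used over the integers (for the lattices) and over the reals (for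
  its inverse and its eigenvalues).  Invertibility is always meant over the reals.\<close>

definition linking_matrix :: "'v::finite plumbing \<Rightarrow> 'r::ring_1 ^ 'v ^ 'v" where
  "linking_matrix \<Gamma> = (\<chi> u v. if u = v then of_int (weight \<Gamma> v) else of_bool (adj \<Gamma> u v))"

definition charpoly :: "real ^ 'v ^ 'v \<Rightarrow> real poly" where
  "charpoly A = det (\<chi> i j. (if i = j then [:0, 1:] else 0) - [:A $ i $ j:])"

definition num_pos_eigenvalues :: "real ^ 'v ^ 'v \<Rightarrow> nat" where
  "num_pos_eigenvalues A = size (filter_mset (\<lambda>x. x > 0) (proots (charpoly A)))"

definition num_neg_eigenvalues :: "real ^ 'v ^ 'v \<Rightarrow> nat" where
  "num_neg_eigenvalues A = size (filter_mset (\<lambda>x. x < 0) (proots (charpoly A)))"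

definition plumbing_pi :: "'v::finite plumbing \<Rightarrow> nat" where
  "plumbing_pi \<Gamma> = num_pos_eigenvalues (linking_matrix \<Gamma>)"

definition plumbing_signature :: "'v::finite plumbing \<Rightarrow> int" where
  "plumbing_signature \<Gamma> =
     int (num_pos_eigenvalues (linking_matrix \<Gamma>)) - int (num_neg_eigenvalues (linking_matrix \<Gamma>))"

definition neg_def_inverse_on :: "'v::finite plumbing \<Rightarrow> 'v set \<Rightarrow> bool" where
  "neg_def_inverse_on \<Gamma> S \<longleftrightarrow>
     (\<forall>x \<in> span ((\<lambda>v. axis v (1::real)) ` S).
        x \<noteq> 0 \<longrightarrow> x \<bullet> (matrix_inv (linking_matrix \<Gamma>) *v x) < 0)"

definition weakly_neg_def :: "'v::finite plumbing \<Rightarrow> bool" where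
  "weakly_neg_def \<Gamma> \<longleftrightarrow>
     invertible (linking_matrix \<Gamma> :: real ^ 'v ^ 'v) \<and>
     neg_def_inverse_on \<Gamma> {v. degree_of \<Gamma> v \<ge> 3}"

definition weakly_neg_def_pair :: "'v::finite plumbing \<Rightarrow> 'v \<Rightarrow> bool" where
  "weakly_neg_def_pair \<Gamma> v0 \<longleftrightarrow>
     invertible (linking_matrix \<Gamma> :: real ^ 'v ^ 'v) \<and>
     neg_def_inverse_on \<Gamma> {v. v \<noteq> v0 \<and> degree_of \<Gamma> v \<ge> 3}"

definition real_vec :: "int ^ 'v \<Rightarrow> real ^ 'v" where
  "real_vec x = (\<chi> v. real_of_int (x $ v))"

definition inverse_form :: "'v::finite plumbing \<Rightarrow> int ^ 'v \<Rightarrow> real" where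
  "inverse_form \<Gamma> x = real_vec x \<bullet> (matrix_inv (linking_matrix \<Gamma>) *v real_vec x)"

section \<open>Spin-c structures\<close>

text \<open>Spin-c structures of the plumbed manifold, and relative ones of the knot complement,
  are given by their combinatorial identifications with cosets in \<open>2\<int>\<^sup>s + \<delta>\<close>.\<close>

definition spinc_vectors :: "'v::finite plumbing \<Rightarrow> (int ^ 'v) set" where
  "spinc_vectors \<Gamma> = {2 *s y + degree_vec \<Gamma> | y. True}"

definition spinc_equiv :: "'v::finite plumbing \<Rightarrow> ((int ^ 'v) \<times> (int ^ 'v)) set" where
  "spinc_equiv \<Gamma> = {(x, x + 2 *s (linking_matrix \<Gamma> *v n)) | x n. True}"

definition rel_spinc_equiv :: "'v::finite plumbing \<Rightarrow> 'v \<Rightarrow> ((int ^ 'v) \<times> (int ^ 'v)) set" where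
  "rel_spinc_equiv \<Gamma> v0 = {(x, x + 2 *s (linking_matrix \<Gamma> *v n)) | x n. n $ v0 = 0}"

definition spinc :: "'v::finite plumbing \<Rightarrow> (int ^ 'v) set set" where
  "spinc \<Gamma> = spinc_vectors \<Gamma> // spinc_equiv \<Gamma>"

definition rel_spinc :: "'v::finite plumbing \<Rightarrow> 'v \<Rightarrow> (int ^ 'v) set set" where
  "rel_spinc \<Gamma> v0 = spinc_vectors \<Gamma> // rel_spinc_equiv \<Gamma> v0"

section \<open>Formal series and principal value integrals\<close>

text \<open>A formal series in real powers of \<open>q\<close> is its coefficient function \<open>real \<Rightarrow> rat\<close>.  All sums of
  coefficients below are \<^const>\<open>Sum_any\<close>: the sum of the nonzero terms, of which there must be
  finitely many (the value is 0 by convention otherwise).\<close>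

definition q_power_times :: "real \<Rightarrow> (real \<Rightarrow> rat) \<Rightarrow> real \<Rightarrow> rat" where
  "q_power_times c f = (\<lambda>e. f (e - c))"

text \<open>Coefficient of \<open>z\<^sup>j\<close> in the average of the Laurent expansions of \<open>(z - 1/z)\<^sup>k\<close> at \<open>z \<rightarrow> 0\<close>
  and at \<open>z \<rightarrow> \<infinity>\<close>; the latter is an expansion in the variable \<open>w = 1/z\<close>, where
  \<open>z - 1/z = 1/w - w\<close>.\<close>

definition pv_coeff :: "int \<Rightarrow> int \<Rightarrow> rat" where
  "pv_coeff k j =
     (fls_nth ((fls_X - fls_X_inv) powi k) j + fls_nth ((fls_X_inv - fls_X) powi k) (- j)) / 2"

text \<open>The integral of \<open>\<Prod>\<^sub>v (z\<^sub>v - 1/z\<^sub>v)\<^bsup>p v\<^esup> \<cdot> f\<close> over the variables \<open>z\<^sub>v\<close> with \<open>v \<in> S\<close>, where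
  \<open>f k e\<close> is the coefficient of \<open>z\<^sup>k q\<^sup>e\<close>: the constant coefficient in these variables, as a series
  in the remaining variables and \<open>q\<close> (so supported on exponents \<open>k\<close> vanishing on \<open>S\<close>).\<close>

definition pv_oint ::
  "'v::finite set \<Rightarrow> ('v \<Rightarrow> int) \<Rightarrow> (int ^ 'v \<Rightarrow> real \<Rightarrow> rat) \<Rightarrow> int ^ 'v \<Rightarrow> real \<Rightarrow> rat" where
  "pv_oint S p f k e =
     (if \<forall>v\<in>S. k $ v = 0
      then Sum_any (\<lambda>l. if \<forall>v. v \<notin> S \<longrightarrow> l $ v = k $ v
                        then (\<Prod>v\<in>S. pv_coeff (p v) (- (l $ v))) * f l e else 0)
      else 0)"

text \<open>\<open>ZQ k s\<close> stands for \<open>(z - 1/z)\<^sup>k \<Sum>\<^sub>j\<^sub>,\<^sub>e s j e z\<^sup>j q\<^sup>e\<close>.  The power of \<open>z - 1/z\<close> is kept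
  unexpanded, since powers have to be combined before expansions are taken.\<close>

datatype zq_series = ZQ (zq_pow: int) (zq_coeff: "int \<Rightarrow> real \<Rightarrow> rat")

definition zq_times_term ::
  "zq_series \<Rightarrow> zq_series \<Rightarrow> int \<Rightarrow> real \<Rightarrow> int \<times> real \<Rightarrow> rat" where
  "zq_times_term F G j e = (\<lambda>(i, d). zq_coeff F i d * zq_coeff G (j - i) (e - d))"

definition zq_times :: "zq_series \<Rightarrow> zq_series \<Rightarrow> zq_series" where
  "zq_times F G = ZQ (zq_pow F + zq_pow G) (\<lambda>j e. Sum_any (zq_times_term F G j e))"

definition zq_times_defined :: "zq_series \<Rightarrow> zq_series \<Rightarrow> bool" where
  "zq_times_defined F G \<longleftrightarrow> (\<forall>j e. finite {x. zq_times_term F G j e x \<noteq> 0})"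

definition pv_oint_z_term :: "zq_series \<Rightarrow> real \<Rightarrow> int \<Rightarrow> rat" where
  "pv_oint_z_term F e j = pv_coeff (zq_pow F) (- j) * zq_coeff F j e"

definition pv_oint_z :: "zq_series \<Rightarrow> real \<Rightarrow> rat" where
  "pv_oint_z F e = Sum_any (pv_oint_z_term F e)"

definition pv_oint_z_defined :: "zq_series \<Rightarrow> bool" where
  "pv_oint_z_defined F \<longleftrightarrow> (\<forall>e. finite {j. pv_oint_z_term F e j \<noteq> 0})"

section \<open>The invariants\<close>

text \<open>\<open>lattice_series \<Gamma> L\<close> is \<open>\<Sum>\<^sub>l\<^sub>\<in>\<^sub>L q\<^bsup>-(l, M\<^sup>-\<^sup>1 l)/4\<^esup> \<Prod>\<^sub>v z\<^sub>v\<^bsup>l v\<^esup>\<close>.\<close>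

definition lattice_series ::
  "'v::finite plumbing \<Rightarrow> (int ^ 'v) set \<Rightarrow> int ^ 'v \<Rightarrow> real \<Rightarrow> rat" where
  "lattice_series \<Gamma> L l e = of_bool (l \<in> L \<and> e = - inverse_form \<Gamma> l / 4)"

definition normalization_exponent :: "'v::finite plumbing \<Rightarrow> real" where
  "normalization_exponent \<Gamma> =
     (3 * real_of_int (plumbing_signature \<Gamma>) - real_of_int (\<Sum>v\<in>UNIV. weight \<Gamma> v)) / 4"

text \<open>The summation lattice \<open>2M\<int>\<^sup>s + a\<close> is the coset \<open>a\<close> itself.\<close>

definition Zhat :: "'v::finite plumbing \<Rightarrow> (int ^ 'v) set \<Rightarrow> real \<Rightarrow> rat" where
  "Zhat \<Gamma> a = (\<lambda>e. (-1) ^ plumbing_pi \<Gamma> *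
     q_power_times (normalization_exponent \<Gamma>)
       (pv_oint UNIV (\<lambda>v. 2 - degree_of \<Gamma> v) (lattice_series \<Gamma> a) 0) e)"

text \<open>The set of vectors \<open>2M\<nu> + x\<close> with \<open>\<nu>\<close> having \<open>v0\<close>-entry \<open>n\<close> is the same for every
  representative \<open>x\<close> of the relative spin-c structure.\<close>

definition knot_lattice :: "'v::finite plumbing \<Rightarrow> 'v \<Rightarrow> (int ^ 'v) set \<Rightarrow> int \<Rightarrow> (int ^ 'v) set" where
  "knot_lattice \<Gamma> v0 a n = {2 *s (linking_matrix \<Gamma> *v \<nu>) + x | \<nu> x. \<nu> $ v0 = n \<and> x \<in> a}"

definition Zhat_knot :: "'v::finite plumbing \<Rightarrow> 'v \<Rightarrow> (int ^ 'v) set \<Rightarrow> int \<Rightarrow> zq_series" where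
  "Zhat_knot \<Gamma> v0 a n = ZQ (1 - degree_of \<Gamma> v0) (\<lambda>j e. (-1) ^ plumbing_pi \<Gamma> *
     q_power_times (normalization_exponent \<Gamma>)
       (pv_oint (- {v0}) (\<lambda>v. 2 - degree_of \<Gamma> v)
          (lattice_series \<Gamma> (knot_lattice \<Gamma> v0 a n)) (axis v0 j)) e)"

section \<open>Gluing\<close>

text \<open>For injections \<open>\<iota>m\<close>, \<open>\<iota>p\<close> each sum has at most one term: entries are copied,
  and added at a vertex that lies in both images.\<close>

definition merge_fun ::
  "('a::finite \<Rightarrow> 'c) \<Rightarrow> ('b::finite \<Rightarrow> 'c) \<Rightarrow> ('a \<Rightarrow> int) \<Rightarrow> ('b \<Rightarrow> int) \<Rightarrow> 'c \<Rightarrow> int" where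
  "merge_fun \<iota>m \<iota>p f g w = (\<Sum>x | \<iota>m x = w. f x) + (\<Sum>y | \<iota>p y = w. g y)"

definition merge_vec ::
  "('a::finite \<Rightarrow> 'c::finite) \<Rightarrow> ('b::finite \<Rightarrow> 'c) \<Rightarrow> int ^ 'a \<Rightarrow> int ^ 'b \<Rightarrow> int ^ 'c" where
  "merge_vec \<iota>m \<iota>p x y = (\<chi> w. merge_fun \<iota>m \<iota>p (($) x) (($) y) w)"

text \<open>\<open>\<Gamma>\<close> is obtained from \<open>\<Gamma>m\<close> and \<open>\<Gamma>p\<close> by identifying \<open>vm\<close> with \<open>vp\<close> and adding their
  weights; \<open>\<iota>m\<close> and \<open>\<iota>p\<close> are the resulting embeddings of the vertex sets.\<close>

definition is_merging ::
  "('a::finite \<Rightarrow> 'c::finite) \<Rightarrow> ('b::finite \<Rightarrow> 'c) \<Rightarrow>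
   'a plumbing \<Rightarrow> 'a \<Rightarrow> 'b plumbing \<Rightarrow> 'b \<Rightarrow> 'c plumbing \<Rightarrow> bool" where
  "is_merging \<iota>m \<iota>p \<Gamma>m vm \<Gamma>p vp \<Gamma> \<longleftrightarrow>
     inj \<iota>m \<and> inj \<iota>p \<and>
     range \<iota>m \<union> range \<iota>p = UNIV \<and> range \<iota>m \<inter> range \<iota>p = {\<iota>m vm} \<and> \<iota>m vm = \<iota>p vp \<and>
     (\<forall>u w. adj \<Gamma> u w \<longleftrightarrow>
        (\<exists>x y. u = \<iota>m x \<and> w = \<iota>m y \<and> adj \<Gamma>m x y) \<or>
        (\<exists>x y. u = \<iota>p x \<and> w = \<iota>p y \<and> adj \<Gamma>p x y)) \<and>
     weight \<Gamma> = merge_fun \<iota>m \<iota>p (weight \<Gamma>m) (weight \<Gamma>p)"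

text \<open>The class of the glued vector, for any choice of representatives.\<close>

definition spinc_glue ::
  "('a::finite \<Rightarrow> 'c::finite) \<Rightarrow> ('b::finite \<Rightarrow> 'c) \<Rightarrow> 'c plumbing \<Rightarrow>
   (int ^ 'a) set \<Rightarrow> (int ^ 'b) set \<Rightarrow> (int ^ 'c) set" where
  "spinc_glue \<iota>m \<iota>p \<Gamma> am ap = (\<Union>x\<in>am. \<Union>y\<in>ap. spinc_equiv \<Gamma> `` {merge_vec \<iota>m \<iota>p x y})"

end

theory Submission
  imports Defs
begin

text \<open>
  The linking matrices satisfy \<open>(\<nu>, M \<nu>) = (\<nu>\<^sup>-, M\<^sup>- \<nu>\<^sup>-) + (\<nu>\<^sup>+, M\<^sup>+ \<nu>\<^sup>+)\<close>, where \<open>\<nu>\<^sup>\<plusminus>\<close> is the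
  restriction of \<open>\<nu>\<close> to the vertices of \<open>\<Gamma>\<^sup>\<plusminus>\<close>.  Hence for \<open>l = x + 2 M \<nu>\<close> the value
  \<open>(l, M\<^sup>-\<^sup>1 l) = (x, M\<^sup>-\<^sup>1 x) + 4 (x, \<nu>) + 4 (\<nu>, M \<nu>)\<close> differs from the sum of the values of the
  two forms at \<open>l\<^sup>\<plusminus> = x\<^sup>\<plusminus> + 2 M\<^sup>\<plusminus> \<nu>\<^sup>\<plusminus>\<close> by a constant, and \<open>l\<close> is the vector glued from \<open>l\<^sup>-\<close> and
  \<open>l\<^sup>+\<close>.  So all series are indexed by \<open>\<nu>\<close>, and the sum over \<open>n\<close>, the coefficient extraction in
  \<open>z\<close> and the product on the right-hand side only group the terms by the entry of \<open>\<nu>\<close> at the merged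
  vertex, by the entry of \<open>l\<close> there, and by the two parts of \<open>l\<close>.

  Regrouping is legitimate because each power of \<open>q\<close> receives finitely many terms: principal value
  coefficients at vertices of degree at most 2 have finite support, and on the remaining
  coordinates \<open>M\<^sup>-\<^sup>1\<close> is negative definite.
\<close>

no_notation fps_nth (infixl \<open>$\<close> 75)

section \<open>Finitely supported sums\<close>

text \<open>Only fibres that meet the finite support contribute, and \<open>\<phi>\<close> maps the
  support to a finite set. The first claim matters by itself: an outer sum with infinite support
  would be 0 by convention.\<close>

lemma Sum_any_fibers:
  fixes h :: "'a \<Rightarrow> 'b::comm_monoid_add"
  assumes "finite {x. h x \<noteq> 0}"
  shows "finite {y. Sum_any (\<lambda>x. if \<phi> x = y then h x else 0) \<noteq> 0}"
    and "Sum_any (\<lambda>y. Sum_any (\<lambda>x. if \<phi> x = y then h x else 0)) = Sum_any h"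
proof -
  let ?A = "{x. h x \<noteq> 0}"
  have inner: "Sum_any (\<lambda>x. if \<phi> x = y then h x else 0) = sum h {x \<in> ?A. \<phi> x = y}" for y
    by (subst Sum_any.expand_superset[of "{x \<in> ?A. \<phi> x = y}"])
      (use assms in \<open>auto intro: sum.cong\<close>)
  have sub: "{y. Sum_any (\<lambda>x. if \<phi> x = y then h x else 0) \<noteq> 0} \<subseteq> \<phi> ` ?A"
  proof
    fix y assume "y \<in> {y. Sum_any (\<lambda>x. if \<phi> x = y then h x else 0) \<noteq> 0}"
    then have "{x \<in> ?A. \<phi> x = y} \<noteq> {}"
      by (auto simp: inner simp del: Collect_empty_eq intro: ccontr)
    then show "y \<in> \<phi> ` ?A" by auto
  qed
  then show "finite {y. Sum_any (\<lambda>x. if \<phi> x = y then h x else 0) \<noteq> 0}"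
    using assms finite_surj by blast
  show "Sum_any (\<lambda>y. Sum_any (\<lambda>x. if \<phi> x = y then h x else 0)) = Sum_any h"
    using sub assms sum.group[of ?A "\<phi> ` ?A" \<phi> h]
    by (subst Sum_any.expand_superset[of "\<phi> ` ?A"]) (simp_all add: inner Sum_any.expand_set)
qed

text \<open>\<open>f\<close> restricts to a bijection between the supports of the two summands, so
  both are finite or both infinite; in the latter case both sums are 0 by convention.\<close>

lemma Sum_any_reindex:
  fixes h :: "'b \<Rightarrow> 'c::comm_monoid_add"
  assumes "inj_on f A"
  shows "Sum_any (\<lambda>y. if y \<in> f ` A then h y else 0) = Sum_any (\<lambda>x. if x \<in> A then h (f x) else 0)"
proof -
  have "{y. (if y \<in> f ` A then h y else 0) \<noteq> 0} = f ` {x. (if x \<in> A then h (f x) else 0) \<noteq> 0}"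
    by auto
  moreover have "inj_on f {x. (if x \<in> A then h (f x) else 0) \<noteq> 0}"
    by (rule inj_on_subset[OF assms]) auto
  ultimately show ?thesis
    unfolding Sum_any.expand_set by (auto simp: sum.reindex intro!: sum.cong)
qed

lemma Sum_any_mult_Sum_any:
  fixes f :: "'a \<Rightarrow> 'c::semiring_0" and g :: "'b \<Rightarrow> 'c"
  assumes "finite {x. f x \<noteq> 0}" "finite {y. g y \<noteq> 0}"
  shows "Sum_any f * Sum_any g = Sum_any (\<lambda>(x, y). f x * g y)"
proof -
  have "Sum_any (\<lambda>(x, y). f x * g y) = (\<Sum>(x, y)\<in>{x. f x \<noteq> 0} \<times> {y. g y \<noteq> 0}. f x * g y)"
    by (rule Sum_any.expand_superset) (use assms in auto)
  then show ?thesis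
    by (simp add: Sum_any.expand_set sum_product sum.cartesian_product)
qed

section \<open>Level sets of the inverse form\<close>

lemma finite_fls_support_mult:
  fixes f g :: "'a::comm_ring_1 fls"
  assumes "finite {j. fls_nth f j \<noteq> 0}"
  shows "finite {j. fls_nth ((fls_X - fls_X_inv) * f) j \<noteq> 0}"
    and "finite {j. fls_nth ((fls_X_inv - fls_X) * f) j \<noteq> 0}"
proof -
  have fin: "finite {j. fls_nth f (j - 1) \<noteq> 0 \<or> fls_nth f (j + 1) \<noteq> 0}"
    unfolding Collect_disj_eq
    using finite_vimageI[OF assms, of "\<lambda>j. j - 1"] finite_vimageI[OF assms, of "\<lambda>j. j + 1"]
    by (simp add: inj_on_def vimage_def)
  show "finite {j. fls_nth ((fls_X - fls_X_inv) * f) j \<noteq> 0}"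
    by (rule finite_subset[OF _ fin])
      (auto simp: left_diff_distrib fls_X_times_conv_shift fls_X_inv_times_conv_shift)
  show "finite {j. fls_nth ((fls_X_inv - fls_X) * f) j \<noteq> 0}"
    by (rule finite_subset[OF _ fin])
      (auto simp: left_diff_distrib fls_X_times_conv_shift fls_X_inv_times_conv_shift)
qed

text \<open>For a nonnegative exponent, \<open>(z - 1/z)^k\<close> is a Laurent polynomial, so both
  expansions are finite. This covers \<open>k = 2 - deg v\<close> at every vertex of degree at most
  2.\<close>

lemma finite_support_pv_coeff:
  assumes "0 \<le> k"
  shows "finite {j. pv_coeff k (- j) \<noteq> 0}"
proof -
  obtain n where k: "k = int n" using assms nonneg_int_cases by blast
  have one: "finite {j. fls_nth (1::rat fls) j \<noteq> 0}"
    by (rule finite_subset[of _ "{0}"]) (auto split: if_splits)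
  have 1: "finite {j. fls_nth ((fls_X - fls_X_inv) ^ n :: rat fls) j \<noteq> 0}"
    by (induction n) (use one in \<open>auto intro: finite_fls_support_mult\<close>)
  have 2: "finite {j. fls_nth ((fls_X_inv - fls_X) ^ n :: rat fls) j \<noteq> 0}"
    by (induction n) (use one in \<open>auto intro: finite_fls_support_mult\<close>)
  have "finite {j. fls_nth ((fls_X - fls_X_inv) ^ n :: rat fls) (- j) \<noteq> 0}"
    using finite_vimageI[OF 1, of uminus] by (simp add: vimage_def)
  then show ?thesis
    by (rule finite_subset[OF _ finite_UnI[OF _ 2], rotated])
      (auto simp: pv_coeff_def k)
qed

section \<open>Lattice points on a level set of a partially negative definite form\<close>

lemma finite_vectors:
  assumes "\<And>v::'v::finite. finite (F v)"
  shows "finite {l :: 'r ^ 'v. \<forall>v. l $ v \<in> F v}"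
proof (rule finite_imageD)
  show "finite (vec_nth ` {l :: 'r ^ 'v. \<forall>v. l $ v \<in> F v})"
    by (rule finite_subset[of _ "PiE UNIV F"]) (use assms in \<open>auto intro: finite_PiE\<close>)
  show "inj_on vec_nth {l :: 'r ^ 'v. \<forall>v. l $ v \<in> F v}"
    by (auto intro: inj_onI simp: vec_nth_inject)
qed

text \<open>By compactness the form attains a maximum on the unit sphere of \<open>V\<close>. It is
  negative there, and homogeneity of degree 2 extends the bound to all of \<open>V\<close>.\<close>

lemma negative_definite_coercive:
  fixes B :: "real ^ 'v ^ 'v"
  assumes V: "subspace V" and neg: "\<And>x. x \<in> V \<Longrightarrow> x \<noteq> 0 \<Longrightarrow> x \<bullet> (B *v x) < 0"
  obtains \<mu> where "\<mu> > 0" "\<And>x. x \<in> V \<Longrightarrow> x \<bullet> (B *v x) \<le> - \<mu> * (norm x)\<^sup>2"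
proof (cases "sphere 0 1 \<inter> V = {}")
  \<comment> \<open>An empty unit sphere means \<open>V\<close> is the zero space, where any
    positive constant works.\<close>
  case True
  have zero: "x = 0" if "x \<in> V" for x
  proof (rule ccontr)
    assume "x \<noteq> 0"
    then have "(1 / norm x) *\<^sub>R x \<in> sphere 0 1 \<inter> V"
      using that subspace_mul[OF V] by auto
    then show False using True by blast
  qed
  have "x \<bullet> (B *v x) \<le> - 1 * (norm x)\<^sup>2" if "x \<in> V" for x
    using zero[OF that] by simp
  then show ?thesis by (rule that[OF zero_less_one])
next
  case False
  have comp: "compact (sphere 0 1 \<inter> V)"
    by (intro compact_Int_closed compact_sphere closed_subspace V)
  have cont: "continuous_on (sphere 0 1 \<inter> V) (\<lambda>x. x \<bullet> (B *v x))"
    by (intro continuous_intros linear_continuous_on_compose matrix_vector_mul_linear)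
  obtain s where s: "s \<in> sphere 0 1 \<inter> V"
    and max: "\<And>y. y \<in> sphere 0 1 \<inter> V \<Longrightarrow> y \<bullet> (B *v y) \<le> s \<bullet> (B *v s)"
    using continuous_attains_sup[OF comp False cont] by blast
  have "x \<bullet> (B *v x) \<le> - (- (s \<bullet> (B *v s))) * (norm x)\<^sup>2" if "x \<in> V" for x
  proof (cases "x = 0")
    case x: False
    let ?y = "(1 / norm x) *\<^sub>R x"
    have "?y \<bullet> (B *v ?y) \<le> s \<bullet> (B *v s)"
      using x that subspace_mul[OF V] by (intro max) auto
    moreover have "?y \<bullet> (B *v ?y) = x \<bullet> (B *v x) / (norm x)\<^sup>2"
      by (simp add: matrix_vector_mult_scaleR power2_eq_square)
    ultimately have "x \<bullet> (B *v x) / (norm x)\<^sup>2 \<le> s \<bullet> (B *v s)" by simp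
    then show ?thesis using x by (simp add: pos_divide_le_eq)
  qed simp
  moreover have "- (s \<bullet> (B *v s)) > 0" using s neg[of s] by force
  ultimately show ?thesis using that by blast
qed

text \<open>Off \<open>S\<close> the entries take finitely many values. On \<open>S\<close> the form
  decreases at least quadratically, while the cross terms grow at most linearly, so a fixed level
  bounds the entries there. Only finitely many integer vectors remain.\<close>

lemma finite_inverse_form_level:
  fixes \<Gamma> :: "'v::finite plumbing"
  assumes neg: "neg_def_inverse_on \<Gamma> S" and F: "\<And>v. v \<notin> S \<Longrightarrow> finite (F v)"
  shows "finite {l. (\<forall>v. v \<notin> S \<longrightarrow> l $ v \<in> F v) \<and> inverse_form \<Gamma> l = c}"
proof -
  define B :: "real ^ 'v ^ 'v" where "B = matrix_inv (linking_matrix \<Gamma>)"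
  define V where "V = span ((\<lambda>v. axis v (1::real)) ` S)"
  define part where "part = (\<lambda>(l :: int ^ 'v). \<chi> v. if v \<in> S then real_of_int (l $ v) else 0)"
  define rest where "rest = (\<lambda>(l :: int ^ 'v). \<chi> v. if v \<in> S then 0 else l $ v)"
  have "subspace V" and "\<And>x. x \<in> V \<Longrightarrow> x \<noteq> 0 \<Longrightarrow> x \<bullet> (B *v x) < 0"
    using neg by (simp_all add: neg_def_inverse_on_def V_def B_def)
  then obtain \<mu> where \<mu>: "\<mu> > 0" "\<And>x. x \<in> V \<Longrightarrow> x \<bullet> (B *v x) \<le> - \<mu> * (norm x)\<^sup>2"
    using negative_definite_coercive by blast
  obtain K where K: "K > 0" "\<And>x. norm (B *v x) \<le> norm x * K"
    using bounded_linear.pos_bounded[OF matrix_vector_mul_bounded_linear[of B]] by blast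
  have "finite {l. \<forall>v. l $ v \<in> (if v \<in> S then {0} else F v)}"
    by (rule finite_vectors) (use F in auto)
  then have "bdd_above ((\<lambda>l. norm (real_vec l)) ` {l. \<forall>v. l $ v \<in> (if v \<in> S then {0} else F v)})"
    by (intro bdd_above_finite finite_imageI)
  then obtain R where R: "norm (real_vec l) \<le> R" if "\<forall>v. l $ v \<in> (if v \<in> S then {0} else F v)" for l
    unfolding bdd_above_def by blast
  \<comment> \<open>\<open>C\<close> adds the bounds for the two cross terms, for the form on the
    rest of the vector, and for the level \<open>c\<close>.\<close>
  define C where "C = 2 * K * R + K * R\<^sup>2 + \<bar>c\<bar>"
  have bound: "norm (part l) \<le> max 1 (C / \<mu>)"
    if l: "\<forall>v. v \<notin> S \<longrightarrow> l $ v \<in> F v" "inverse_form \<Gamma> l = c" for l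
  proof (cases "norm (part l) \<le> 1")
    case False
    define y f where "y = part l" and "f = real_vec (rest l)"
    have split: "real_vec l = y + f"
      by (simp add: y_def f_def part_def rest_def real_vec_def vec_eq_iff)
    have fR: "norm f \<le> R"
      unfolding f_def by (rule R) (use l in \<open>auto simp: rest_def\<close>)
    have "y = (\<Sum>v\<in>S. real_of_int (l $ v) *\<^sub>R axis v 1)"
      by (auto simp: y_def part_def vec_eq_iff axis_def if_distrib cong: if_cong)
    then have "y \<in> V"
      unfolding V_def by (simp only:) (intro span_sum span_scale span_base imageI)
    then have yy: "y \<bullet> (B *v y) \<le> - \<mu> * (norm y)\<^sup>2" using \<mu> by blast
    have bil: "\<bar>u \<bullet> (B *v w)\<bar> \<le> norm u * (norm w * K)" for u w
      using Cauchy_Schwarz_ineq2[of u "B *v w"] K(2)[of w]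
      by (meson mult_left_mono norm_ge_zero order_trans)
    have "R \<ge> 0" using fR norm_ge_zero order_trans by blast
    have b1: "\<bar>y \<bullet> (B *v f)\<bar> \<le> norm y * (R * K)"
    proof -
      have "norm y * (norm f * K) \<le> norm y * (R * K)"
        using fR K(1) by (intro mult_left_mono mult_right_mono) auto
      then show ?thesis using bil[of y f] by linarith
    qed
    have b2: "\<bar>f \<bullet> (B *v y)\<bar> \<le> norm y * (R * K)"
    proof -
      have "norm f * (norm y * K) \<le> R * (norm y * K)"
        using fR K(1) by (intro mult_right_mono) auto
      then show ?thesis using bil[of f y] by (simp add: mult_ac)
    qed
    have b3: "\<bar>f \<bullet> (B *v f)\<bar> \<le> R * (R * K)"
    proof -
      have "norm f * (norm f * K) \<le> R * (R * K)"
        using fR K(1) \<open>R \<ge> 0\<close> by (intro mult_mono mult_right_mono) auto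
      then show ?thesis using bil[of f f] by linarith
    qed
    have "c = y \<bullet> (B *v y) + y \<bullet> (B *v f) + f \<bullet> (B *v y) + f \<bullet> (B *v f)"
      using l(2) unfolding inverse_form_def split B_def[symmetric]
      by (simp add: matrix_vector_right_distrib inner_add_left inner_add_right)
    then have "\<mu> * (norm y)\<^sup>2 \<le> 2 * (norm y * (R * K)) + R * (R * K) + \<bar>c\<bar>"
      using yy b1 b2 b3 by linarith
    \<comment> \<open>Since \<open>norm y > 1\<close>, the constant terms may be multiplied by
      \<open>norm y\<close>; then one factor \<open>norm y\<close> cancels.\<close>
    also have "\<dots> \<le> 2 * (norm y * (R * K)) + norm y * (R * (R * K)) + norm y * \<bar>c\<bar>"
    proof -
      have "1 * (R * (R * K)) \<le> norm y * (R * (R * K))" "1 * \<bar>c\<bar> \<le> norm y * \<bar>c\<bar>"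
        using False K(1) \<open>R \<ge> 0\<close> unfolding y_def by (intro mult_right_mono; simp)+
      then show ?thesis by simp
    qed
    also have "\<dots> = C * norm y"
      by (simp add: C_def algebra_simps power2_eq_square)
    finally have "(\<mu> * norm y) * norm y \<le> C * norm y"
      by (simp add: power2_eq_square mult.assoc)
    moreover have "norm y > 0" using False unfolding y_def by linarith
    ultimately have "\<mu> * norm y \<le> C" by (rule mult_right_le_imp_le)
    then show ?thesis using \<mu>(1) unfolding y_def by (simp add: field_simps le_max_iff_disj)
  qed simp
  define D where "D = \<lceil>max 1 (C / \<mu>)\<rceil>"
  have fin: "finite {l :: int ^ 'v. \<forall>v. l $ v \<in> (if v \<in> S then {- D..D} else F v)}"
    by (rule finite_vectors) (use F in auto)
  have box: "l $ v \<in> {- D..D}"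
    if "\<forall>v. v \<notin> S \<longrightarrow> l $ v \<in> F v" "inverse_form \<Gamma> l = c" "v \<in> S" for l v
  proof -
    have "\<bar>part l $ v\<bar> \<le> max 1 (C / \<mu>)"
      using bound[OF that(1,2)] component_le_norm_cart[of "part l" v] by linarith
    also have "\<dots> \<le> of_int D" unfolding D_def by (rule le_of_int_ceiling)
    finally have "\<bar>real_of_int (l $ v)\<bar> \<le> of_int D" using that(3) by (simp add: part_def)
    then have "\<bar>l $ v\<bar> \<le> D" by linarith
    then show ?thesis by auto
  qed
  show ?thesis
    by (rule finite_subset[OF _ fin]) (use box in \<open>simp add: subset_iff\<close>)
qed

lemma neg_def_inverse_on_mono:
  "neg_def_inverse_on \<Gamma> S \<Longrightarrow> T \<subseteq> S \<Longrightarrow> neg_def_inverse_on \<Gamma> T"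
  unfolding neg_def_inverse_on_def by (meson image_mono span_mono subsetD)

text \<open>A nonzero product has only nonzero factors, which confines the entries at vertices of
  \<open>T\<close> of degree at most 2 to finite sets. Entries off \<open>T\<close> are prescribed
  by \<open>k\<close>, and the form is negative definite on what is left.\<close>

lemma finite_pv_support_level:
  fixes \<Gamma> :: "'v::finite plumbing"
  assumes "neg_def_inverse_on \<Gamma> S" and "{v \<in> T. degree_of \<Gamma> v \<ge> 3} \<subseteq> S"
  shows "finite {l. (\<Prod>v\<in>T. pv_coeff (2 - degree_of \<Gamma> v) (- (l $ v))) \<noteq> 0 \<and>
    (\<forall>v. v \<notin> T \<longrightarrow> l $ v = k $ v) \<and> inverse_form \<Gamma> l = c}"
proof (rule finite_subset)
  let ?S = "{v \<in> T. degree_of \<Gamma> v \<ge> 3}"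
  let ?F = "\<lambda>v. if v \<in> T then {j. pv_coeff (2 - degree_of \<Gamma> v) (- j) \<noteq> 0} else {k $ v}"
  show "finite {l. (\<forall>v. v \<notin> ?S \<longrightarrow> l $ v \<in> ?F v) \<and> inverse_form \<Gamma> l = c}"
    by (rule finite_inverse_form_level)
      (use assms neg_def_inverse_on_mono in \<open>auto intro: finite_support_pv_coeff\<close>)
qed auto

section \<open>The inverse form on cosets of the lattice\<close>

lemma matrix_inv_inverse:
  assumes "invertible A"
  shows matrix_inv_right: "A ** matrix_inv A = mat 1"
    and matrix_inv_left: "matrix_inv A ** A = mat 1"
  using someI_ex[OF assms[unfolded invertible_def]] unfolding matrix_inv_def by blast+

text \<open>By Cramer's rule the entries of the inverse matrix applied to \<open>x\<close> are
  quotients of determinants of rational matrices.\<close>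

lemma inverse_form_rational:
  fixes \<Gamma> :: "'v::finite plumbing"
  assumes "invertible (linking_matrix \<Gamma> :: real ^ 'v ^ 'v)"
  shows "inverse_form \<Gamma> x \<in> \<rat>"
proof -
  let ?M = "linking_matrix \<Gamma> :: real ^ 'v ^ 'v"
  define y where "y = matrix_inv ?M *v real_vec x"
  have det_Rats: "det A \<in> \<rat>" if "\<And>i j. A $ i $ j \<in> \<rat>" for A :: "real ^ 'v ^ 'v"
    unfolding det_def using that by (intro Rats_sum Rats_mult Rats_prod) auto
  have entries: "?M $ i $ j \<in> \<rat>" for i j
    by (simp add: linking_matrix_def)
  have "?M *v y = real_vec x"
    unfolding y_def matrix_vector_mul_assoc matrix_inv_right[OF assms] by simp
  then have "y = (\<chi> k. det (\<chi> i j. if j = k then real_vec x $ i else ?M $ i $ j) / det ?M)"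
    using cramer assms invertible_det_nz by blast
  moreover have "det (\<chi> i j. if j = k then real_vec x $ i else ?M $ i $ j) / det ?M \<in> \<rat>" for k
    by (intro Rats_divide det_Rats entries) (use entries in \<open>auto simp: real_vec_def\<close>)
  ultimately have "y $ k \<in> \<rat>" for k
    by simp
  then show ?thesis
    unfolding inverse_form_def y_def[symmetric] inner_vec_def
    by (intro Rats_sum) (simp add: real_vec_def)
qed

lemma real_vec_linking_matrix:
  "real_vec (linking_matrix \<Gamma> *v \<nu>) = linking_matrix \<Gamma> *v real_vec \<nu>"
  by (auto simp: real_vec_def linking_matrix_def matrix_vector_mult_def vec_eq_iff of_bool_def
      intro!: sum.cong)

lemma real_vec_add: "real_vec (x + y) = real_vec x + real_vec y"
  by (simp add: real_vec_def vec_eq_iff)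

lemma real_vec_smult: "real_vec (c *s x) = real_of_int c *\<^sub>R real_vec x"
  by (simp add: real_vec_def vec_eq_iff)

lemma inner_real_vec: "real_vec x \<bullet> real_vec y = real_of_int (\<Sum>v\<in>UNIV. x $ v * y $ v)"
  by (simp add: inner_vec_def real_vec_def)

text \<open>Symmetry of the linking matrix cancels it against its inverse in the cross terms. The
  change of the form is thus an integral pairing without an inverse matrix, which can be compared
  across a merging.\<close>

lemma inverse_form_translate:
  fixes \<Gamma> :: "'v::finite plumbing"
  assumes "symp (adj \<Gamma>)" and inv: "invertible (linking_matrix \<Gamma> :: real ^ 'v ^ 'v)"
  shows "inverse_form \<Gamma> (x + 2 *s (linking_matrix \<Gamma> *v \<nu>)) =
    inverse_form \<Gamma> x + 4 * real_of_int (\<Sum>v\<in>UNIV. \<nu> $ v * (x + linking_matrix \<Gamma> *v \<nu>) $ v)"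
proof -
  let ?M = "linking_matrix \<Gamma> :: real ^ 'v ^ 'v"
  have sym: "transpose ?M = ?M"
    using assms(1) by (auto simp: transpose_def linking_matrix_def vec_eq_iff of_bool_def dest: sympD)
  let ?x = "real_vec x" and ?n = "real_vec \<nu>" and ?B = "matrix_inv ?M"
  have BM: "?B *v (?M *v ?n) = ?n" and MB: "?M *v (?B *v ?x) = ?x"
    unfolding matrix_vector_mul_assoc matrix_inv_right[OF inv] matrix_inv_left[OF inv] by simp_all
  have "(?M *v ?n) \<bullet> (?B *v ?x) = ?n \<bullet> ?x"
    using dot_lmul_matrix[of ?n ?M "?B *v ?x"] sym MB transpose_matrix_vector[of ?M ?n] by simp
  then have "inverse_form \<Gamma> (x + 2 *s (linking_matrix \<Gamma> *v \<nu>)) =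
      ?x \<bullet> (?B *v ?x) + 4 * (?n \<bullet> (?x + ?M *v ?n))"
    unfolding inverse_form_def real_vec_add real_vec_smult real_vec_linking_matrix
    by (simp add: matrix_vector_right_distrib matrix_vector_mult_scaleR BM inner_add_left
        inner_add_right inner_commute)
  then show ?thesis
    unfolding inverse_form_def inner_real_vec[symmetric] real_vec_add real_vec_linking_matrix .
qed

section \<open>Parametrization of cosets by integer vectors\<close>

lemma inj_lattice_param:
  fixes \<Gamma> :: "'v::finite plumbing" and x :: "int ^ 'v"
  assumes inv: "invertible (linking_matrix \<Gamma> :: real ^ 'v ^ 'v)"
  shows "inj (\<lambda>\<nu>. x + 2 *s (linking_matrix \<Gamma> *v \<nu>))"
proof (rule injI)
  let ?M = "linking_matrix \<Gamma> :: real ^ 'v ^ 'v"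
  fix \<nu> \<nu>' assume "x + 2 *s (linking_matrix \<Gamma> *v \<nu>) = x + 2 *s (linking_matrix \<Gamma> *v \<nu>')"
  then have "linking_matrix \<Gamma> *v \<nu> = linking_matrix \<Gamma> *v \<nu>'"
    by (simp add: vec_eq_iff)
  then have "matrix_inv ?M *v (?M *v real_vec \<nu>) = matrix_inv ?M *v (?M *v real_vec \<nu>')"
    by (simp flip: real_vec_linking_matrix)
  then have "real_vec \<nu> = real_vec \<nu>'"
    unfolding matrix_vector_mul_assoc matrix_inv_left[OF inv] by simp
  then show "\<nu> = \<nu>'" by (simp add: real_vec_def vec_eq_iff)
qed

text \<open>Passing from the base point \<open>y\<close> of the quotient to another member
  \<open>x\<close> only shifts the parameter by a fixed vector \<open>k\<close>.\<close>

lemma spinc_eq_range: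
  assumes "a \<in> spinc \<Gamma>" "x \<in> a"
  shows "a = range (\<lambda>\<nu>. x + 2 *s (linking_matrix \<Gamma> *v \<nu>))"
proof -
  obtain y where a: "a = range (\<lambda>\<nu>. y + 2 *s (linking_matrix \<Gamma> *v \<nu>))"
    using assms(1) by (auto simp: spinc_def spinc_equiv_def quotient_def)
  then obtain k where k: "x = y + 2 *s (linking_matrix \<Gamma> *v k)" using assms(2) by blast
  have "y + 2 *s (linking_matrix \<Gamma> *v \<nu>) = x + 2 *s (linking_matrix \<Gamma> *v (\<nu> - k))"
    and "x + 2 *s (linking_matrix \<Gamma> *v \<nu>) = y + 2 *s (linking_matrix \<Gamma> *v (\<nu> + k))" for \<nu>
    by (simp_all add: k matrix_vector_mult_diff_distrib matrix_vector_right_distrib vec_eq_iff)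
  then show ?thesis unfolding a by blast
qed

text \<open>Representatives of a relative class differ by a parameter \<open>k\<close> with
  \<open>v0\<close>-entry 0, so changing the representative keeps the condition on
  \<open>n\<close>.\<close>

lemma knot_lattice_eq:
  assumes "a \<in> rel_spinc \<Gamma> v0" "x \<in> a"
  shows "knot_lattice \<Gamma> v0 a n = {x + 2 *s (linking_matrix \<Gamma> *v \<nu>) | \<nu>. \<nu> $ v0 = n}"
proof -
  obtain y where a: "a = {y + 2 *s (linking_matrix \<Gamma> *v \<nu>) | \<nu>. \<nu> $ v0 = 0}"
    using assms(1) by (auto simp: rel_spinc_def rel_spinc_equiv_def quotient_def)
  then obtain k where k: "x = y + 2 *s (linking_matrix \<Gamma> *v k)" "k $ v0 = 0" using assms(2) by blast
  have "\<exists>\<nu>. \<nu> $ v0 = n \<and> 2 *s (linking_matrix \<Gamma> *v \<mu>) + (y + 2 *s (linking_matrix \<Gamma> *v \<mu>')) =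
      x + 2 *s (linking_matrix \<Gamma> *v \<nu>)" if "\<mu> $ v0 = n" "\<mu>' $ v0 = 0" for \<mu> \<mu>'
    using that k(2)
    by (intro exI[of _ "\<mu> + \<mu>' - k"])
      (simp add: k(1) matrix_vector_mult_diff_distrib matrix_vector_right_distrib vec_eq_iff)
  then have "knot_lattice \<Gamma> v0 a n \<subseteq> {x + 2 *s (linking_matrix \<Gamma> *v \<nu>) | \<nu>. \<nu> $ v0 = n}"
    unfolding knot_lattice_def a by blast
  moreover have "{x + 2 *s (linking_matrix \<Gamma> *v \<nu>) | \<nu>. \<nu> $ v0 = n} \<subseteq> knot_lattice \<Gamma> v0 a n"
    unfolding knot_lattice_def using assms(2) by (auto simp: add.commute)
  ultimately show ?thesis by blast
qed

section \<open>Merging of plumbings\<close>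

definition pullback :: "('a::finite \<Rightarrow> 'c::finite) \<Rightarrow> int ^ 'c \<Rightarrow> int ^ 'a" where
  "pullback \<iota> \<nu> = (\<chi> v. \<nu> $ \<iota> v)"

lemma pullback_nth [simp]: "pullback \<iota> \<nu> $ v = \<nu> $ \<iota> v"
  by (simp add: pullback_def)

lemma sum_over_fibers:
  fixes h :: "'c::finite \<Rightarrow> 'a::finite \<Rightarrow> 'r::comm_monoid_add"
  shows "(\<Sum>w\<in>UNIV. \<Sum>x | \<iota> x = w. h w x) = (\<Sum>x\<in>UNIV. h (\<iota> x) x)"
proof -
  have "(\<Sum>w\<in>UNIV. \<Sum>x | \<iota> x = w. h w x) = (\<Sum>w\<in>UNIV. \<Sum>x | \<iota> x = w. h (\<iota> x) x)"
    by (intro sum.cong) auto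
  also have "\<dots> = (\<Sum>x\<in>UNIV. h (\<iota> x) x)"
    using sum.group[of UNIV UNIV \<iota> "\<lambda>x. h (\<iota> x) x"] by simp
  finally show ?thesis .
qed

text \<open>Merging is a sum of two pushforwards, and pushforward along a map is adjoint to
  restriction along it.\<close>

lemma merge_vec_pairing:
  "(\<Sum>w\<in>UNIV. \<nu> $ w * merge_vec \<iota>m \<iota>p x y $ w) =
    (\<Sum>v\<in>UNIV. pullback \<iota>m \<nu> $ v * x $ v) + (\<Sum>v\<in>UNIV. pullback \<iota>p \<nu> $ v * y $ v)"
  by (simp add: merge_vec_def merge_fun_def distrib_left sum.distrib sum_distrib_left sum_over_fibers)

lemma merge_vec_add:
  "merge_vec \<iota>m \<iota>p (x + x') (y + y') = merge_vec \<iota>m \<iota>p x y + merge_vec \<iota>m \<iota>p x' y'"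
  by (simp add: merge_vec_def merge_fun_def vec_eq_iff sum.distrib)

lemma merge_vec_smult: "merge_vec \<iota>m \<iota>p (c *s x) (c *s y) = c *s merge_vec \<iota>m \<iota>p x y"
  by (simp add: merge_vec_def merge_fun_def vec_eq_iff sum_distrib_left distrib_left)

section \<open>The merged tree compared with its two pieces\<close>

locale merging =
  fixes \<Gamma>m :: "'a::finite plumbing" and vm :: 'a
    and \<Gamma>p :: "'b::finite plumbing" and vp :: 'b
    and \<Gamma> :: "'c::finite plumbing"
    and \<iota>m :: "'a \<Rightarrow> 'c" and \<iota>p :: "'b \<Rightarrow> 'c"
  assumes treem: "plumbing_tree \<Gamma>m" and treep: "plumbing_tree \<Gamma>p"
    and merging: "is_merging \<iota>m \<iota>p \<Gamma>m vm \<Gamma>p vp \<Gamma>"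
begin

lemma inj: "inj \<iota>m" "inj \<iota>p"
  using merging by (auto simp: is_merging_def)

lemma vertex_cases:
  obtains (minus) x where "w = \<iota>m x" | (plus) y where "w = \<iota>p y"
proof -
  have "w \<in> range \<iota>m \<union> range \<iota>p"
    using merging by (simp add: is_merging_def)
  then show ?thesis using that by blast
qed

text \<open>The two images meet only in the merged vertex, so these rules decide equality between
  embedded vertices.\<close>

lemma \<iota>_simps [simp]:
  "\<iota>m x = \<iota>m x' \<longleftrightarrow> x = x'" "\<iota>p y = \<iota>p y' \<longleftrightarrow> y = y'"
  "\<iota>m x = \<iota>p y \<longleftrightarrow> x = vm \<and> y = vp" "\<iota>p y = \<iota>m x \<longleftrightarrow> x = vm \<and> y = vp"
proof -
  have I: "range \<iota>m \<inter> range \<iota>p = {\<iota>m vm}" and v: "\<iota>m vm = \<iota>p vp"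
    using merging by (auto simp: is_merging_def)
  show "\<iota>m x = \<iota>m x' \<longleftrightarrow> x = x'" "\<iota>p y = \<iota>p y' \<longleftrightarrow> y = y'"
    using inj by (auto dest: injD)
  show *: "\<iota>m x = \<iota>p y \<longleftrightarrow> x = vm \<and> y = vp"
  proof
    assume eq: "\<iota>m x = \<iota>p y"
    then have "\<iota>m x \<in> range \<iota>m \<inter> range \<iota>p" by (metis IntI rangeI)
    then have "\<iota>m x = \<iota>m vm" "\<iota>p y = \<iota>p vp" using I v eq by auto
    then show "x = vm \<and> y = vp" using inj by (auto dest: injD)
  qed (use v in auto)
  then show "\<iota>p y = \<iota>m x \<longleftrightarrow> x = vm \<and> y = vp" by metis
qed

lemma no_loops [simp]: "\<not> adj \<Gamma>m x x" "\<not> adj \<Gamma>p y y"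
  using treem treep by (auto simp: plumbing_tree_def irreflp_def)

lemma symp_adj: "symp (adj \<Gamma>m)" "symp (adj \<Gamma>p)" "symp (adj \<Gamma>)"
proof -
  show m: "symp (adj \<Gamma>m)" and p: "symp (adj \<Gamma>p)"
    using treem treep by (auto simp: plumbing_tree_def)
  show "symp (adj \<Gamma>)"
    using merging unfolding is_merging_def by (intro sympI) (metis m p sympD)
qed

lemma adj_iff:
  "adj \<Gamma> u w \<longleftrightarrow> (\<exists>x y. u = \<iota>m x \<and> w = \<iota>m y \<and> adj \<Gamma>m x y) \<or>
    (\<exists>x y. u = \<iota>p x \<and> w = \<iota>p y \<and> adj \<Gamma>p x y)"
  using merging by (auto simp: is_merging_def)

lemma adj_simps:
  "adj \<Gamma> (\<iota>m x) (\<iota>m x') \<longleftrightarrow> adj \<Gamma>m x x'"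
  "adj \<Gamma> (\<iota>p y) (\<iota>p y') \<longleftrightarrow> adj \<Gamma>p y y'"
  "adj \<Gamma> (\<iota>m x) (\<iota>p y) \<longleftrightarrow> (y = vp \<and> adj \<Gamma>m x vm) \<or> (x = vm \<and> adj \<Gamma>p vp y)"
  "adj \<Gamma> (\<iota>p y) (\<iota>m x) \<longleftrightarrow> (y = vp \<and> adj \<Gamma>m vm x) \<or> (x = vm \<and> adj \<Gamma>p y vp)"
  by (auto simp: adj_iff)

lemma fibers:
  "{x'. \<iota>m x' = \<iota>m x} = {x}" "{y'. \<iota>p y' = \<iota>p y} = {y}"
  "{x'. \<iota>m x' = \<iota>p y} = (if y = vp then {vm} else {})"
  "{y'. \<iota>p y' = \<iota>m x} = (if x = vm then {vp} else {})"
  by auto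

lemma merge_vec_nth:
  "v \<noteq> vm \<Longrightarrow> merge_vec \<iota>m \<iota>p x y $ \<iota>m v = x $ v"
  "v' \<noteq> vp \<Longrightarrow> merge_vec \<iota>m \<iota>p x y $ \<iota>p v' = y $ v'"
  "merge_vec \<iota>m \<iota>p x y $ \<iota>m vm = x $ vm + y $ vp"
  by (simp_all add: merge_vec_def merge_fun_def fibers)

lemma weight_eq: "weight \<Gamma> = merge_fun \<iota>m \<iota>p (weight \<Gamma>m) (weight \<Gamma>p)"
  using merging by (simp add: is_merging_def)

lemma sum_weight: "(\<Sum>w\<in>UNIV. weight \<Gamma> w) = (\<Sum>v\<in>UNIV. weight \<Gamma>m v) + (\<Sum>v\<in>UNIV. weight \<Gamma>p v)"
  by (simp add: weight_eq merge_fun_def sum.distrib sum_over_fibers)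

text \<open>The linking matrix is the sum of those of the pieces, extended by zero: weights add at
  the merged vertex, and no edge lies in both pieces since they share a single vertex and have no
  loops.\<close>

lemma linking_matrix_entry:
  "(linking_matrix \<Gamma> :: int ^ 'c ^ 'c) $ w $ u =
    (\<Sum>x | \<iota>m x = w. \<Sum>x' | \<iota>m x' = u. linking_matrix \<Gamma>m $ x $ x') +
    (\<Sum>y | \<iota>p y = w. \<Sum>y' | \<iota>p y' = u. linking_matrix \<Gamma>p $ y $ y')"
  by (cases w rule: vertex_cases; cases u rule: vertex_cases;
      auto simp: linking_matrix_def fibers weight_eq merge_fun_def adj_simps of_bool_def
        intro!: sum.neutral)

lemma linking_matrix_mult:
  "linking_matrix \<Gamma> *v \<nu> =
    merge_vec \<iota>m \<iota>p (linking_matrix \<Gamma>m *v pullback \<iota>m \<nu>) (linking_matrix \<Gamma>p *v pullback \<iota>p \<nu>)"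
proof -
  have swap: "(\<Sum>u\<in>UNIV. (\<Sum>x\<in>X. \<Sum>x' | \<iota> x' = u. A $ x $ x') * \<nu> $ u) =
      (\<Sum>x\<in>X. \<Sum>x'\<in>UNIV. A $ x $ x' * \<nu> $ \<iota> x')"
    for X :: "'x::finite set" and \<iota> :: "'x \<Rightarrow> 'c" and A :: "int ^ 'x ^ 'x"
    unfolding sum_distrib_right by (subst sum.swap) (simp add: sum_over_fibers)
  show ?thesis
    unfolding vec_eq_iff
    by (simp add: matrix_vector_mult_def merge_vec_def merge_fun_def linking_matrix_entry
        distrib_right sum.distrib swap)
qed

text \<open>The neighbours of the merged vertex in the two pieces are disjoint: a common one would
  be the merged vertex itself, which has no loop.\<close>

lemma degree_eq:
  "v \<noteq> vm \<Longrightarrow> degree_of \<Gamma> (\<iota>m v) = degree_of \<Gamma>m v"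
  "v' \<noteq> vp \<Longrightarrow> degree_of \<Gamma> (\<iota>p v') = degree_of \<Gamma>p v'"
  "degree_of \<Gamma> (\<iota>m vm) = degree_of \<Gamma>m vm + degree_of \<Gamma>p vp"
proof -
  have "{u. adj \<Gamma> (\<iota>m v) u} = \<iota>m ` {u. adj \<Gamma>m v u}" if "v \<noteq> vm" for v
    using that by (auto simp: adj_iff)
  then show "v \<noteq> vm \<Longrightarrow> degree_of \<Gamma> (\<iota>m v) = degree_of \<Gamma>m v"
    by (simp add: degree_of_def card_image inj_on_def)
  have "{u. adj \<Gamma> (\<iota>p v) u} = \<iota>p ` {u. adj \<Gamma>p v u}" if "v \<noteq> vp" for v
    using that by (auto simp: adj_iff)
  then show "v' \<noteq> vp \<Longrightarrow> degree_of \<Gamma> (\<iota>p v') = degree_of \<Gamma>p v'"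
    by (simp add: degree_of_def card_image inj_on_def)
  have "{u. adj \<Gamma> (\<iota>m vm) u} = \<iota>m ` {u. adj \<Gamma>m vm u} \<union> \<iota>p ` {u. adj \<Gamma>p vp u}"
    by (auto simp: adj_iff)
  moreover have "\<iota>m ` {u. adj \<Gamma>m vm u} \<inter> \<iota>p ` {u. adj \<Gamma>p vp u} = {}"
    by auto
  ultimately show "degree_of \<Gamma> (\<iota>m vm) = degree_of \<Gamma>m vm + degree_of \<Gamma>p vp"
    by (simp add: degree_of_def card_Un_disjoint card_image inj_on_def)
qed

lemma prod_merging:
  "(\<Prod>w\<in>- {\<iota>m vm}. f w) = (\<Prod>v\<in>- {vm}. f (\<iota>m v)) * (\<Prod>v\<in>- {vp}. f (\<iota>p v))"
  for f :: "'c \<Rightarrow> 'r::comm_monoid_mult"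
proof -
  have "- {\<iota>m vm} = \<iota>m ` (- {vm}) \<union> \<iota>p ` (- {vp})"
  proof (rule set_eqI)
    show "w \<in> - {\<iota>m vm} \<longleftrightarrow> w \<in> \<iota>m ` (- {vm}) \<union> \<iota>p ` (- {vp})" for w
      by (cases w rule: vertex_cases) auto
  qed
  moreover have "\<iota>m ` (- {vm}) \<inter> \<iota>p ` (- {vp}) = {}"
    by auto
  ultimately show ?thesis
    by (simp add: prod.union_disjoint prod.reindex inj_on_def)
qed

end

section \<open>Sums over the gluing lattice\<close>

abbreviation pv_weight :: "'v::finite plumbing \<Rightarrow> 'v set \<Rightarrow> int ^ 'v \<Rightarrow> rat" where
  "pv_weight \<Gamma> S l \<equiv> \<Prod>v\<in>S. pv_coeff (2 - degree_of \<Gamma> v) (- (l $ v))"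

abbreviation q_exponent :: "'v::finite plumbing \<Rightarrow> int ^ 'v \<Rightarrow> real" where
  "q_exponent \<Gamma> l \<equiv> normalization_exponent \<Gamma> - inverse_form \<Gamma> l / 4"

text \<open>Each factor is a sum over monomials indexed by \<open>l\<close> or \<open>l'\<close>. A
  term of the convolution collects the pairs whose first member has prescribed exponents of
  \<open>z\<close> and \<open>q\<close>, so the product regroups the sum over all pairs.\<close>

lemma zq_times_coeff:
  fixes f :: "'x \<Rightarrow> rat" and g :: "'y \<Rightarrow> rat" and E :: "'x \<Rightarrow> real"
  assumes F: "\<And>i d. zq_coeff F i d = Sum_any (\<lambda>l. if (A l, E l) = (i, d) then f l else 0)"
    and G: "\<And>i d. zq_coeff G i d = Sum_any (\<lambda>l. if (B l, E' l) = (i, d) then g l else 0)"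
    and finF: "\<And>i d. finite {l. f l \<noteq> 0 \<and> A l = i \<and> E l = d}"
    and finG: "\<And>i d. finite {l. g l \<noteq> 0 \<and> B l = i \<and> E' l = d}"
    and fin: "\<And>j e. finite {(l, l'). f l * g l' \<noteq> 0 \<and> A l + B l' = j \<and> E l + E' l' = e}"
  shows "zq_times_defined F G"
    and "zq_coeff (zq_times F G) j e =
      Sum_any (\<lambda>(l, l'). if A l + B l' = j \<and> E l + E' l' = e then f l * g l' else 0)"
proof -
  let ?h = "\<lambda>j e (l, l'). if A l + B l' = j \<and> E l + E' l' = e then f l * g l' else 0"
  let ?\<phi> = "\<lambda>(l, l'). (A l, E l)"
  have h: "finite {x. ?h j e x \<noteq> 0}" for j e
    by (rule finite_subset[OF _ fin[of j e]]) (auto split: if_splits)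
  have fiber: "zq_times_term F G j e y = Sum_any (\<lambda>x. if ?\<phi> x = y then ?h j e x else 0)" for j e y
  proof (cases y)
    case (Pair i d)
    have "finite {l. (if (A l, E l) = (i, d) then f l else 0) \<noteq> 0}"
      by (rule finite_subset[OF _ finF[of i d]]) (auto split: if_splits)
    moreover have "finite {l. (if (B l, E' l) = (j - i, e - d) then g l else 0) \<noteq> 0}"
      by (rule finite_subset[OF _ finG[of "j - i" "e - d"]]) (auto split: if_splits)
    ultimately show ?thesis
      unfolding Pair zq_times_term_def prod.case F G
      by (subst Sum_any_mult_Sum_any) (auto intro!: Sum_any.cong)
  qed
  show "zq_times_defined F G"
    unfolding zq_times_defined_def fiber using Sum_any_fibers(1)[OF h] by blast
  show "zq_coeff (zq_times F G) j e = Sum_any (?h j e)"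
  proof -
    have "zq_times_term F G j e = (\<lambda>y. Sum_any (\<lambda>x. if ?\<phi> x = y then ?h j e x else 0))"
      by (rule ext) (rule fiber)
    then show ?thesis
      unfolding zq_times_def zq_series.sel by (simp only: Sum_any_fibers(2)[OF h])
  qed
qed

text \<open>The constant coefficient groups the monomials by their power of \<open>z\<close>.
  Finiteness for one power lets \<open>pv_coeff\<close> move into the inner sum; finiteness over all
  powers makes the grouping legitimate.\<close>

lemma pv_oint_z_eq:
  fixes w :: "'t \<Rightarrow> rat" and E :: "'t \<Rightarrow> real"
  assumes F: "\<And>j e. zq_coeff F j e = Sum_any (\<lambda>t. if \<psi> t = j \<and> E t = e then w t else 0)"
    and fin_j: "\<And>j e. finite {t. w t \<noteq> 0 \<and> \<psi> t = j \<and> E t = e}"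
    and fin: "\<And>e. finite {t. pv_coeff (zq_pow F) (- \<psi> t) * w t \<noteq> 0 \<and> E t = e}"
  shows "pv_oint_z_defined F"
    and "pv_oint_z F e = Sum_any (\<lambda>t. if E t = e then pv_coeff (zq_pow F) (- \<psi> t) * w t else 0)"
proof -
  let ?h = "\<lambda>e t. if E t = e then pv_coeff (zq_pow F) (- \<psi> t) * w t else 0"
  have h: "finite {t. ?h e t \<noteq> 0}" for e
    by (rule finite_subset[OF _ fin[of e]]) (auto split: if_splits)
  have fiber: "pv_oint_z_term F e j = Sum_any (\<lambda>t. if \<psi> t = j then ?h e t else 0)" for e j
  proof -
    have "finite {t. (if \<psi> t = j \<and> E t = e then w t else 0) \<noteq> 0}"
      by (rule finite_subset[OF _ fin_j[of j e]]) (auto split: if_splits)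
    then show ?thesis
      unfolding pv_oint_z_term_def F
      by (subst Sum_any_right_distrib) (auto intro!: Sum_any.cong)
  qed
  show "pv_oint_z_defined F"
    unfolding pv_oint_z_defined_def fiber using Sum_any_fibers(1)[OF h] by blast
  show "pv_oint_z F e = Sum_any (?h e)"
    unfolding pv_oint_z_def fiber by (rule Sum_any_fibers(2)[OF h])
qed

text \<open>Fixing the power \<open>d\<close> of \<open>q\<close> puts \<open>l\<close> on one level
  set of the inverse form, and fixing \<open>j\<close> removes the only variable that is not
  integrated.\<close>

lemma finite_knot_support:
  assumes "weakly_neg_def_pair \<Gamma> v0"
  shows "finite {l. pv_weight \<Gamma> (- {v0}) l \<noteq> 0 \<and> l $ v0 = j \<and> q_exponent \<Gamma> l = d}"
  by (rule finite_subset[OF _ finite_pv_support_level[of \<Gamma> _ "- {v0}" "axis v0 j"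
        "4 * (normalization_exponent \<Gamma> - d)"]])
    (use assms in \<open>auto simp: weakly_neg_def_pair_def\<close>)

text \<open>This puts the knot series into the shape required by \<open>zq_times_coeff\<close>, with
  lattice membership turned into a factor of the summand.\<close>

lemma zq_coeff_Zhat_knot:
  assumes "weakly_neg_def_pair \<Gamma> v0"
  shows "zq_coeff (Zhat_knot \<Gamma> v0 a n) j d = Sum_any (\<lambda>l. if (l $ v0, q_exponent \<Gamma> l) = (j, d)
    then of_bool (l \<in> knot_lattice \<Gamma> v0 a n) * ((-1) ^ plumbing_pi \<Gamma> * pv_weight \<Gamma> (- {v0}) l) else 0)"
proof -
  let ?h = "\<lambda>l. if \<forall>v. v \<notin> - {v0} \<longrightarrow> l $ v = axis v0 j $ v
    then pv_weight \<Gamma> (- {v0}) l * lattice_series \<Gamma> (knot_lattice \<Gamma> v0 a n) l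
      (d - normalization_exponent \<Gamma>) else 0"
  have "finite {l. ?h l \<noteq> 0}"
    by (rule finite_subset[OF _ finite_knot_support[OF assms, of j d]])
      (auto simp: lattice_series_def split: if_splits)
  then have "(-1) ^ plumbing_pi \<Gamma> * Sum_any ?h = Sum_any (\<lambda>l. (-1) ^ plumbing_pi \<Gamma> * ?h l)"
    by (rule Sum_any_right_distrib)
  also have "\<dots> = Sum_any (\<lambda>l. if (l $ v0, q_exponent \<Gamma> l) = (j, d)
    then of_bool (l \<in> knot_lattice \<Gamma> v0 a n) * ((-1) ^ plumbing_pi \<Gamma> * pv_weight \<Gamma> (- {v0}) l) else 0)"
    by (rule Sum_any.cong) (auto simp: lattice_series_def)
  finally show ?thesis
    by (simp add: Zhat_knot_def q_power_times_def pv_oint_def axis_def)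
qed

lemma finite_closed_support:
  assumes "weakly_neg_def \<Gamma>"
  shows "finite {l. pv_weight \<Gamma> UNIV l \<noteq> 0 \<and> q_exponent \<Gamma> l = d}"
  by (rule finite_subset[OF _ finite_pv_support_level[of \<Gamma> _ UNIV 0
        "4 * (normalization_exponent \<Gamma> - d)"]])
    (use assms in \<open>auto simp: weakly_neg_def_def\<close>)

lemma Zhat_eq:
  assumes "weakly_neg_def \<Gamma>" "a \<in> spinc \<Gamma>" "x \<in> a"
  shows "Zhat \<Gamma> a e = (-1) ^ plumbing_pi \<Gamma> * Sum_any (\<lambda>\<nu>.
    if q_exponent \<Gamma> (x + 2 *s (linking_matrix \<Gamma> *v \<nu>)) = e
    then pv_weight \<Gamma> UNIV (x + 2 *s (linking_matrix \<Gamma> *v \<nu>)) else 0)"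
proof -
  let ?g = "\<lambda>\<nu>. x + 2 *s (linking_matrix \<Gamma> *v \<nu>)"
  have inj: "inj ?g"
    using assms(1) by (intro inj_lattice_param) (simp add: weakly_neg_def_def)
  have "Sum_any (\<lambda>l. pv_weight \<Gamma> UNIV l * lattice_series \<Gamma> a l (e - normalization_exponent \<Gamma>)) =
    Sum_any (\<lambda>l. if l \<in> range ?g then if q_exponent \<Gamma> l = e then pv_weight \<Gamma> UNIV l else 0 else 0)"
    unfolding spinc_eq_range[OF assms(2,3)]
    by (rule Sum_any.cong) (auto simp: lattice_series_def)
  also have "\<dots> = Sum_any (\<lambda>\<nu>. if q_exponent \<Gamma> (?g \<nu>) = e then pv_weight \<Gamma> UNIV (?g \<nu>) else 0)"
    by (subst Sum_any_reindex[OF inj]) simp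
  finally show ?thesis
    by (simp add: Zhat_def q_power_times_def pv_oint_def)
qed

section \<open>Gluing of two knot complements\<close>

locale gluing = merging \<Gamma>m vm \<Gamma>p vp \<Gamma> \<iota>m \<iota>p
  for \<Gamma>m :: "'a::finite plumbing" and vm
    and \<Gamma>p :: "'b::finite plumbing" and vp
    and \<Gamma> :: "'c::finite plumbing"
    and \<iota>m \<iota>p +
  fixes xm :: "int ^ 'a" and xp :: "int ^ 'b" and am ap
  assumes knotm: "weakly_neg_def_pair \<Gamma>m vm" and knotp: "weakly_neg_def_pair \<Gamma>p vp"
    and closed: "weakly_neg_def \<Gamma>"
    and spincm: "am \<in> rel_spinc \<Gamma>m vm" "xm \<in> am" and spincp: "ap \<in> rel_spinc \<Gamma>p vp" "xp \<in> ap"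
begin

definition "x\<^sub>0 = merge_vec \<iota>m \<iota>p xm xp"
definition "lattice_pt \<nu> = x\<^sub>0 + 2 *s (linking_matrix \<Gamma> *v \<nu>)"
definition "lattice_ptm \<nu> = xm + 2 *s (linking_matrix \<Gamma>m *v pullback \<iota>m \<nu>)"
definition "lattice_ptp \<nu> = xp + 2 *s (linking_matrix \<Gamma>p *v pullback \<iota>p \<nu>)"

definition "gluing_exponent = 3 / 4 * real_of_int
    (plumbing_signature \<Gamma> - plumbing_signature \<Gamma>m - plumbing_signature \<Gamma>p)
    - 1 / 4 * (inverse_form \<Gamma> x\<^sub>0 - inverse_form \<Gamma>m xm - inverse_form \<Gamma>p xp)"

lemma invs: "invertible (linking_matrix \<Gamma>m :: real ^ 'a ^ 'a)"
  "invertible (linking_matrix \<Gamma>p :: real ^ 'b ^ 'b)" "invertible (linking_matrix \<Gamma> :: real ^ 'c ^ 'c)"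
  using knotm knotp closed by (simp_all add: weakly_neg_def_pair_def weakly_neg_def_def)

lemma gluing_exponent_rational: "gluing_exponent \<in> \<rat>"
  unfolding gluing_exponent_def
  by (intro Rats_diff Rats_mult Rats_divide inverse_form_rational invs) simp_all

lemma lattice_pt_merge: "lattice_pt \<nu> = merge_vec \<iota>m \<iota>p (lattice_ptm \<nu>) (lattice_ptp \<nu>)"
  by (simp add: lattice_pt_def lattice_ptm_def lattice_ptp_def x\<^sub>0_def linking_matrix_mult
      merge_vec_add merge_vec_smult)

text \<open>The change of each form under translation is a pairing with \<nu> or a restriction of
  it. By \<open>merge_vec_pairing\<close> the pairing on \<Gamma> is the sum of the two others, so
  everything depending on \<nu> cancels.\<close>

lemma inverse_form_lattice_pt:
  "inverse_form \<Gamma> (lattice_pt \<nu>) - inverse_form \<Gamma>m (lattice_ptm \<nu>) - inverse_form \<Gamma>p (lattice_ptp \<nu>) =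
    inverse_form \<Gamma> x\<^sub>0 - inverse_form \<Gamma>m xm - inverse_form \<Gamma>p xp"
  using merge_vec_pairing[of \<nu> \<iota>m \<iota>p "xm + linking_matrix \<Gamma>m *v pullback \<iota>m \<nu>"
      "xp + linking_matrix \<Gamma>p *v pullback \<iota>p \<nu>"]
  unfolding lattice_pt_def lattice_ptm_def lattice_ptp_def
    inverse_form_translate[OF symp_adj(1) invs(1)] inverse_form_translate[OF symp_adj(2) invs(2)]
    inverse_form_translate[OF symp_adj(3) invs(3)] merge_vec_add x\<^sub>0_def[symmetric]
    linking_matrix_mult[symmetric]
  by simp

text \<open>Total weights add under merging, so only signatures and base points enter the
  difference, which is \<xi>.\<close>

lemma q_exponent_lattice_pt:
  "q_exponent \<Gamma> (lattice_pt \<nu>) =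
    q_exponent \<Gamma>m (lattice_ptm \<nu>) + q_exponent \<Gamma>p (lattice_ptp \<nu>) + gluing_exponent"
  unfolding gluing_exponent_def inverse_form_lattice_pt[of \<nu>, symmetric]
  by (simp add: normalization_exponent_def sum_weight field_simps)

lemma inj_lattice_pt: "inj lattice_pt"
  unfolding lattice_pt_def by (rule inj_lattice_param[OF invs(3)])

lemma inj_lattice_pts: "inj (\<lambda>\<nu>. (lattice_ptm \<nu>, lattice_ptp \<nu>))"
  using inj_lattice_pt by (auto simp: inj_def lattice_pt_merge)

text \<open>Parameters on the two sides with the same entry \<open>n\<close> at the distinguished
  vertices are exactly the restrictions of one \<nu> on \<Gamma>. Using the same \<open>n\<close> in
  both knot series is what makes the gluing work.\<close>

lemma knot_lattices:
  "knot_lattice \<Gamma>m vm am n \<times> knot_lattice \<Gamma>p vp ap n =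
    (\<lambda>\<nu>. (lattice_ptm \<nu>, lattice_ptp \<nu>)) ` {\<nu>. \<nu> $ \<iota>m vm = n}"
proof (intro equalityI subsetI)
  fix p assume "p \<in> knot_lattice \<Gamma>m vm am n \<times> knot_lattice \<Gamma>p vp ap n"
  then obtain \<mu> \<mu>' where p: "p = (xm + 2 *s (linking_matrix \<Gamma>m *v \<mu>), xp + 2 *s (linking_matrix \<Gamma>p *v \<mu>'))"
    and n: "\<mu> $ vm = n" "\<mu>' $ vp = n"
    unfolding knot_lattice_eq[OF spincm] knot_lattice_eq[OF spincp] by blast
  \<comment> \<open>merging adds up the two entries \<open>n\<close> at the common vertex\<close>
  define \<nu> where "\<nu> = merge_vec \<iota>m \<iota>p \<mu> \<mu>' - axis (\<iota>m vm) n"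
  have "pullback \<iota>m \<nu> $ v = \<mu> $ v" for v
    using n by (cases "v = vm") (simp_all add: \<nu>_def merge_vec_nth axis_def)
  moreover have "pullback \<iota>p \<nu> $ v = \<mu>' $ v" for v
  proof (cases "v = vp")
    case True
    \<comment> \<open>This equation serves as a rewrite rule below; \<open>\<iota>_simps\<close>
      would reduce it to \<open>True\<close>.\<close>
    have "\<iota>p vp = \<iota>m vm" by simp
    then show ?thesis using n True by (simp add: \<nu>_def merge_vec_nth axis_def del: \<iota>_simps)
  qed (simp add: \<nu>_def merge_vec_nth axis_def)
  ultimately have "pullback \<iota>m \<nu> = \<mu>" "pullback \<iota>p \<nu> = \<mu>'"
    by (simp_all only: vec_eq_iff) simp_all
  then have "p = (lattice_ptm \<nu>, lattice_ptp \<nu>)" "\<nu> $ \<iota>m vm = n"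
    using n by (auto simp: p lattice_ptm_def lattice_ptp_def)
  then show "p \<in> (\<lambda>\<nu>. (lattice_ptm \<nu>, lattice_ptp \<nu>)) ` {\<nu>. \<nu> $ \<iota>m vm = n}" by blast
next
  fix p assume "p \<in> (\<lambda>\<nu>. (lattice_ptm \<nu>, lattice_ptp \<nu>)) ` {\<nu>. \<nu> $ \<iota>m vm = n}"
  then obtain \<nu> where \<nu>: "p = (lattice_ptm \<nu>, lattice_ptp \<nu>)" "\<nu> $ \<iota>m vm = n" by blast
  have "pullback \<iota>m \<nu> $ vm = n" "pullback \<iota>p \<nu> $ vp = n"
    using \<nu>(2) \<iota>_simps(3)[of vm vp, THEN iffD2] by (simp_all del: \<iota>_simps)
  then show "p \<in> knot_lattice \<Gamma>m vm am n \<times> knot_lattice \<Gamma>p vp ap n"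
    unfolding knot_lattice_eq[OF spincm] knot_lattice_eq[OF spincp]
    using \<nu>(1) by (auto simp: lattice_ptm_def lattice_ptp_def)
qed

lemma lattice_pt_merged_vertex: "lattice_pt \<nu> $ \<iota>m vm = lattice_ptm \<nu> $ vm + lattice_ptp \<nu> $ vp"
  by (simp add: lattice_pt_merge merge_vec_nth)

lemma pv_weight_lattice_pt:
  "pv_weight \<Gamma> (- {\<iota>m vm}) (lattice_pt \<nu>) =
    pv_weight \<Gamma>m (- {vm}) (lattice_ptm \<nu>) * pv_weight \<Gamma>p (- {vp}) (lattice_ptp \<nu>)"
  unfolding prod_merging lattice_pt_merge
  by (intro arg_cong2[where f = times] prod.cong) (auto simp: merge_vec_nth degree_eq)

text \<open>The exponent at the merged vertex is the sum of the exponents \<open>1 - deg\<close> in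
  the two knot series, so combining powers before expanding yields the same coefficient as in the
  closed invariant.\<close>

lemma pv_weight_UNIV_lattice_pt:
  "pv_weight \<Gamma> UNIV (lattice_pt \<nu>) =
    pv_coeff (2 - degree_of \<Gamma>m vm - degree_of \<Gamma>p vp) (- (lattice_ptm \<nu> $ vm + lattice_ptp \<nu> $ vp)) *
    (pv_weight \<Gamma>m (- {vm}) (lattice_ptm \<nu>) * pv_weight \<Gamma>p (- {vp}) (lattice_ptp \<nu>))"
proof -
  have "pv_weight \<Gamma> UNIV (lattice_pt \<nu>) =
      pv_coeff (2 - degree_of \<Gamma> (\<iota>m vm)) (- (lattice_pt \<nu> $ \<iota>m vm)) *
      pv_weight \<Gamma> (- {\<iota>m vm}) (lattice_pt \<nu>)"
    by (subst prod.remove[of UNIV "\<iota>m vm"]) (simp_all add: Compl_eq_Diff_UNIV)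
  then show ?thesis
    by (simp only: pv_weight_lattice_pt lattice_pt_merged_vertex degree_eq diff_diff_eq)
qed

section \<open>Sums over pairs of lattice vectors\<close>

abbreviation "pairs \<equiv> \<lambda>n. knot_lattice \<Gamma>m vm am n \<times> knot_lattice \<Gamma>p vp ap n"

definition knot_sign :: rat where
  "knot_sign = (-1) ^ plumbing_pi \<Gamma>m * (-1) ^ plumbing_pi \<Gamma>p"

text \<open>This is the contribution of the monomials \<open>l\<close> and \<open>l'\<close> to the
  coefficient of \<open>q^e\<close> in the integrated product.\<close>

definition "pair_term e = (\<lambda>(l, l'). if q_exponent \<Gamma>m l + q_exponent \<Gamma>p l' = e
   then knot_sign * (pv_coeff (2 - degree_of \<Gamma>m vm - degree_of \<Gamma>p vp) (- (l $ vm + l' $ vp)) *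
      (pv_weight \<Gamma>m (- {vm}) l * pv_weight \<Gamma>p (- {vp}) l')) else 0)"

text \<open>Only the sums of the exponents of the two members are prescribed, so finiteness is taken
  from \<Gamma>: the conditions on a pair become conditions on the glued vector, and \<Gamma> with
  the merged vertex is itself a weakly negative definite pair.\<close>

lemma finite_pairs_fixed_power:
  "finite {(l, l') \<in> pairs n. pv_weight \<Gamma>m (- {vm}) l * pv_weight \<Gamma>p (- {vp}) l' \<noteq> 0 \<and>
    l $ vm + l' $ vp = j \<and> q_exponent \<Gamma>m l + q_exponent \<Gamma>p l' = e}"
proof (rule finite_subset)
  let ?L = "{l. pv_weight \<Gamma> (- {\<iota>m vm}) l \<noteq> 0 \<and> l $ \<iota>m vm = j \<and> q_exponent \<Gamma> l = e + gluing_exponent}"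
  have "weakly_neg_def_pair \<Gamma> (\<iota>m vm)"
    using closed unfolding weakly_neg_def_pair_def weakly_neg_def_def
    by (auto elim: neg_def_inverse_on_mono)
  then have "finite ?L" by (rule finite_knot_support)
  then show "finite ((\<lambda>\<nu>. (lattice_ptm \<nu>, lattice_ptp \<nu>)) ` (lattice_pt -` ?L))"
    using inj_lattice_pt by (intro finite_imageI finite_vimageI)
  show "{(l, l') \<in> pairs n. pv_weight \<Gamma>m (- {vm}) l * pv_weight \<Gamma>p (- {vp}) l' \<noteq> 0 \<and>
      l $ vm + l' $ vp = j \<and> q_exponent \<Gamma>m l + q_exponent \<Gamma>p l' = e} \<subseteq>
    (\<lambda>\<nu>. (lattice_ptm \<nu>, lattice_ptp \<nu>)) ` (lattice_pt -` ?L)"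
    unfolding knot_lattices
    by (clarify, rule imageI)
      (simp only: vimage_eq mem_Collect_eq pv_weight_lattice_pt lattice_pt_merged_vertex
        q_exponent_lattice_pt, simp)
qed

text \<open>Here all variables are integrated and \<nu> is unrestricted, so weak negative
  definiteness of \<Gamma> gives finiteness for all \<open>n\<close> at once.\<close>

lemma finite_params: "finite {\<nu>. pair_term e (lattice_ptm \<nu>, lattice_ptp \<nu>) \<noteq> 0}"
proof (rule finite_subset)
  let ?L = "{l. pv_weight \<Gamma> UNIV l \<noteq> 0 \<and> q_exponent \<Gamma> l = e + gluing_exponent}"
  show "finite (lattice_pt -` ?L)"
    using inj_lattice_pt finite_closed_support[OF closed] by (rule finite_vimageI[rotated])
  show "{\<nu>. pair_term e (lattice_ptm \<nu>, lattice_ptp \<nu>) \<noteq> 0} \<subseteq> lattice_pt -` ?L"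
    unfolding pair_term_def prod.case
    by (auto simp only: vimage_eq mem_Collect_eq pv_weight_UNIV_lattice_pt q_exponent_lattice_pt
        split: if_splits)
qed

lemma knot_product:
  defines "P \<equiv> \<lambda>n. zq_times (Zhat_knot \<Gamma>m vm am n) (Zhat_knot \<Gamma>p vp ap n)"
  shows "zq_times_defined (Zhat_knot \<Gamma>m vm am n) (Zhat_knot \<Gamma>p vp ap n)"
    and "pv_oint_z_defined (P n)"
    and "pv_oint_z (P n) e = Sum_any (\<lambda>\<nu>. if \<nu> $ \<iota>m vm = n
      then pair_term e (lattice_ptm \<nu>, lattice_ptp \<nu>) else 0)"
proof -
  let ?f = "\<lambda>l. of_bool (l \<in> knot_lattice \<Gamma>m vm am n) * ((-1) ^ plumbing_pi \<Gamma>m * pv_weight \<Gamma>m (- {vm}) l)"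
  let ?g = "\<lambda>l. of_bool (l \<in> knot_lattice \<Gamma>p vp ap n) * ((-1) ^ plumbing_pi \<Gamma>p * pv_weight \<Gamma>p (- {vp}) l)"
  let ?w = "\<lambda>(l, l'). ?f l * ?g l'"
  let ?\<psi> = "\<lambda>(l, l'). l $ vm + l' $ vp"
  let ?E = "\<lambda>(l, l'). q_exponent \<Gamma>m l + q_exponent \<Gamma>p l'"
  have fin: "finite {(l, l'). ?f l * ?g l' \<noteq> 0 \<and> l $ vm + l' $ vp = j \<and>
      q_exponent \<Gamma>m l + q_exponent \<Gamma>p l' = e}" for j e
    by (rule finite_subset[OF _ finite_pairs_fixed_power[of n j e]]) auto
  have finm: "finite {l. ?f l \<noteq> 0 \<and> l $ vm = i \<and> q_exponent \<Gamma>m l = d}" for i d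
    by (rule finite_subset[OF _ finite_knot_support[OF knotm, of i d]]) auto
  have finp: "finite {l. ?g l \<noteq> 0 \<and> l $ vp = i \<and> q_exponent \<Gamma>p l = d}" for i d
    by (rule finite_subset[OF _ finite_knot_support[OF knotp, of i d]]) auto
  note times = zq_times_coeff[OF zq_coeff_Zhat_knot[OF knotm] zq_coeff_Zhat_knot[OF knotp] finm finp fin]
  show "zq_times_defined (Zhat_knot \<Gamma>m vm am n) (Zhat_knot \<Gamma>p vp ap n)"
    by (rule times(1))
  have coeff: "zq_coeff (P n) j e = Sum_any (\<lambda>t. if ?\<psi> t = j \<and> ?E t = e then ?w t else 0)" for j e
    unfolding P_def times(2) by (rule Sum_any.cong) (simp split: prod.splits)
  have fin_w: "finite {t. ?w t \<noteq> 0 \<and> ?\<psi> t = j \<and> ?E t = e}" for j e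
    by (rule finite_subset[OF _ fin[of j e]]) auto
  have pow: "zq_pow (P n) = 2 - degree_of \<Gamma>m vm - degree_of \<Gamma>p vp"
    by (simp add: P_def zq_times_def Zhat_knot_def)
  \<comment> \<open>The two lattice indicators combine into membership in \<open>pairs n\<close>;
    the remaining factors make up \<open>pair_term\<close>.\<close>
  have summand: "(if ?E t = e then pv_coeff (zq_pow (P n)) (- ?\<psi> t) * ?w t else 0) =
      (if t \<in> pairs n then pair_term e t else 0)" for t e
    by (cases t; cases "fst t \<in> knot_lattice \<Gamma>m vm am n"; cases "snd t \<in> knot_lattice \<Gamma>p vp ap n")
      (simp_all add: pair_term_def pow knot_sign_def)
  have fin_pairs: "finite {t. (if t \<in> pairs n then pair_term e t else 0) \<noteq> 0}" for e
    unfolding knot_lattices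
    by (rule finite_subset[OF _ finite_imageI[OF finite_params[of e],
          of "\<lambda>\<nu>. (lattice_ptm \<nu>, lattice_ptp \<nu>)"]]) auto
  have fin_pv: "finite {t. pv_coeff (zq_pow (P n)) (- ?\<psi> t) * ?w t \<noteq> 0 \<and> ?E t = e}" for e
  proof (rule finite_subset[OF _ fin_pairs[of e]], rule subsetI)
    fix t assume "t \<in> {t. pv_coeff (zq_pow (P n)) (- ?\<psi> t) * ?w t \<noteq> 0 \<and> ?E t = e}"
    then have "(if ?E t = e then pv_coeff (zq_pow (P n)) (- ?\<psi> t) * ?w t else 0) \<noteq> 0"
      by (simp only: mem_Collect_eq if_True simp_thms)
    then show "t \<in> {t. (if t \<in> pairs n then pair_term e t else 0) \<noteq> 0}"
      by (simp only: summand mem_Collect_eq not_False_eq_True)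
  qed
  note pv = pv_oint_z_eq[OF coeff fin_w fin_pv]
  show "pv_oint_z_defined (P n)" by (rule pv(1))
  have "pv_oint_z (P n) e = Sum_any (\<lambda>t. if t \<in> pairs n then pair_term e t else 0)"
    unfolding pv(2) by (simp only: summand)
  also have "\<dots> = Sum_any (\<lambda>\<nu>. if \<nu> $ \<iota>m vm = n
      then pair_term e (lattice_ptm \<nu>, lattice_ptp \<nu>) else 0)"
    unfolding knot_lattices by (subst Sum_any_reindex[OF inj_on_subset[OF inj_lattice_pts]]) auto
  finally show "pv_oint_z (P n) e = \<dots>" .
qed

text \<open>Grouping all \<nu> by their entry at the merged vertex turns the closed invariant into
  the sum over \<open>n\<close>. The exponent of \<open>q\<close> shifts by
  \<open>gluing_exponent\<close>, and the signs differ by the power \<tau>.\<close>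

lemma Zhat_gluing:
  assumes a: "a \<in> spinc \<Gamma>" "x\<^sub>0 \<in> a"
    and \<tau>: "\<tau> = int (plumbing_pi \<Gamma>) - int (plumbing_pi \<Gamma>m) - int (plumbing_pi \<Gamma>p)"
  defines "I \<equiv> \<lambda>n e. pv_oint_z (zq_times (Zhat_knot \<Gamma>m vm am n) (Zhat_knot \<Gamma>p vp ap n)) e"
  shows "finite {n. I n e \<noteq> 0}"
    and "Zhat \<Gamma> a = q_power_times gluing_exponent (\<lambda>e. (-1) powi \<tau> * Sum_any (\<lambda>n. I n e))"
proof -
  note fibers = Sum_any_fibers[OF finite_params, of "\<lambda>\<nu>. \<nu> $ \<iota>m vm", folded knot_product(3)]
  show "finite {n. I n e \<noteq> 0}" unfolding I_def by (rule fibers(1))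
  have sign: "(-1) ^ plumbing_pi \<Gamma> = (-1) powi \<tau> * knot_sign"
    by (simp add: \<tau> knot_sign_def power_int_diff power_int_of_nat)
  show "Zhat \<Gamma> a = q_power_times gluing_exponent (\<lambda>e. (-1) powi \<tau> * Sum_any (\<lambda>n. I n e))"
  proof
    fix e
    let ?e = "e - gluing_exponent"
    let ?h = "\<lambda>\<nu>. if q_exponent \<Gamma> (lattice_pt \<nu>) = e then pv_weight \<Gamma> UNIV (lattice_pt \<nu>) else 0"
    have pair_term: "pair_term ?e (lattice_ptm \<nu>, lattice_ptp \<nu>) = knot_sign * ?h \<nu>" for \<nu>
      unfolding pv_weight_UNIV_lattice_pt q_exponent_lattice_pt by (auto simp: pair_term_def)
    \<comment> \<open>A nonzero sign leaves the support unchanged, so the finiteness of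
      \<open>pair_term\<close> passes to \<open>?h\<close>.\<close>
    have "knot_sign \<noteq> 0" by (simp add: knot_sign_def)
    then have fin: "finite {\<nu>. ?h \<nu> \<noteq> 0}"
      using finite_params[of ?e] unfolding pair_term by simp
    have "Zhat \<Gamma> a e = (-1) ^ plumbing_pi \<Gamma> * Sum_any ?h"
      unfolding lattice_pt_def by (rule Zhat_eq[OF closed a])
    moreover have "knot_sign * Sum_any ?h = Sum_any (\<lambda>n. I n ?e)"
      unfolding I_def fibers(2) pair_term by (rule Sum_any_right_distrib[OF fin])
    ultimately have "Zhat \<Gamma> a e = (-1) powi \<tau> * Sum_any (\<lambda>n. I n ?e)"
      by (simp only: sign mult.assoc)
    then show "Zhat \<Gamma> a e =
        q_power_times gluing_exponent (\<lambda>e. (-1) powi \<tau> * Sum_any (\<lambda>n. I n e)) e"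
      by (simp add: q_power_times_def)
  qed
qed

end

theorem theorem1p1:
  fixes \<Gamma>m :: "'a::finite plumbing" and vm :: 'a
    and \<Gamma>p :: "'b::finite plumbing" and vp :: 'b
    and \<Gamma> :: "'c::finite plumbing"
    and \<iota>m :: "'a \<Rightarrow> 'c" and \<iota>p :: "'b \<Rightarrow> 'c"
    and am :: "(int ^ 'a) set" and ap :: "(int ^ 'b) set" and a :: "(int ^ 'c) set"
    and xm :: "int ^ 'a" and xp :: "int ^ 'b" and x :: "int ^ 'c"
    and \<tau> :: int and \<xi> :: real
  assumes "plumbing_tree \<Gamma>m" and "plumbing_tree \<Gamma>p"
    and "weakly_neg_def_pair \<Gamma>m vm" and "weakly_neg_def_pair \<Gamma>p vp"
    and "is_merging \<iota>m \<iota>p \<Gamma>m vm \<Gamma>p vp \<Gamma>"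
    and "weakly_neg_def \<Gamma>"
    and "am \<in> rel_spinc \<Gamma>m vm" and "ap \<in> rel_spinc \<Gamma>p vp" and "a \<in> spinc \<Gamma>"
    and "spinc_glue \<iota>m \<iota>p \<Gamma> am ap = a"
    and "xm \<in> am" and "xp \<in> ap" and "x = merge_vec \<iota>m \<iota>p xm xp"
    and "\<tau> = int (plumbing_pi \<Gamma>) - int (plumbing_pi \<Gamma>m) - int (plumbing_pi \<Gamma>p)"
    and "\<xi> = 3 / 4 * real_of_int
               (plumbing_signature \<Gamma> - plumbing_signature \<Gamma>m - plumbing_signature \<Gamma>p)
             - 1 / 4 * (inverse_form \<Gamma> x - inverse_form \<Gamma>m xm - inverse_form \<Gamma>p xp)"
  shows "\<xi> \<in> \<rat> \<and>
    (\<forall>n. zq_times_defined (Zhat_knot \<Gamma>m vm am n) (Zhat_knot \<Gamma>p vp ap n) \<and>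
         pv_oint_z_defined (zq_times (Zhat_knot \<Gamma>m vm am n) (Zhat_knot \<Gamma>p vp ap n))) \<and>
    (\<forall>e. finite {n. pv_oint_z (zq_times (Zhat_knot \<Gamma>m vm am n) (Zhat_knot \<Gamma>p vp ap n)) e \<noteq> 0}) \<and>
    Zhat \<Gamma> a = q_power_times \<xi> (\<lambda>e. (-1) powi \<tau> *
      Sum_any (\<lambda>n::int.
        pv_oint_z (zq_times (Zhat_knot \<Gamma>m vm am n) (Zhat_knot \<Gamma>p vp ap n)) e))"
proof -
  interpret gluing \<Gamma>m vm \<Gamma>p vp \<Gamma> \<iota>m \<iota>p xm xp am ap
    by unfold_locales (use assms in auto)
  have x0: "x\<^sub>0 = x"
    using assms by (simp add: x\<^sub>0_def)
  \<comment> \<open>The parameter 0 shows that \<open>x\<close> lies in its own class, hence in the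
    glued class \<open>a\<close>.\<close>
  have "(x, x + 2 *s (linking_matrix \<Gamma> *v 0)) \<in> spinc_equiv \<Gamma>"
    unfolding spinc_equiv_def by blast
  then have "(x, x) \<in> spinc_equiv \<Gamma>" by simp
  then have "x\<^sub>0 \<in> a"
    using assms unfolding spinc_glue_def x0 by blast
  note glue = Zhat_gluing[OF \<open>a \<in> spinc \<Gamma>\<close> this \<open>\<tau> = _\<close>]
  have "gluing_exponent = \<xi>"
    unfolding gluing_exponent_def x0 \<open>\<xi> = _\<close> ..
  then show ?thesis
    using gluing_exponent_rational knot_product(1,2) glue by simp
qed

end
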